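(* Let $\mathcal{D}$ be a triangulated category with a surjection $\nu\colon K(\mathcal{D})\to\Lambda$ onto a finite rank lattice. Suppose $\mathcal{D}$ has a split generator $G$. Let $\mathrm{Stab}^\circ_\Lambda(\mathcal{D})$ be a connected component of $\mathrm{Stab}_\Lambda(\mathcal{D})$, let $\sigma\in\mathrm{Stab}^\circ_\Lambda(\mathcal{D})$, and let $\alpha\in\mathrm{Aut}^{\mathrm{o}}_\Lambda(\mathcal{D})$ be an exact auto-equivalence preserving this component. Then the eventual displacement $d(\overline{\alpha})$ of the isometry $\overline{\alpha}$ of $\mathrm{Stab}^\circ_\Lambda(\mathcal{D})/\mathbb{C}$ induced by $\alpha$ satisfies $$d(\overline{\alpha})\ \geq\ \frac{h_{\sigma,0}(\alpha)+h_{\sigma,0}(\alpha^{-1})}{2}.$$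
   Context: Setting: $\mathcal{D}$ is a non-zero triangulated category with shift $[1]$ and Grothendieck group $K(\mathcal{D})$; $\nu\colon K(\mathcal{D})\to\Lambda$ is a fixed surjection onto a finite rank lattice, and $\|\cdot\|$ is a fixed norm on $\Lambda\otimes\mathbb{R}$. A split generator is an object $G$ such that the smallest thick subcategory of $\mathcal{D}$ containing $G$ is $\mathcal{D}$. Stability conditions: a stability condition $\sigma=(P,Z)$ consists of an additive homomorphism $Z\colon\Lambda\to\mathbb{C}$ and full additive subcategories $P(\phi)\subset\mathcal{D}$ ($\phi\in\mathbb{R}$; non-zero objects are called semistable of phase $\phi$) such that (1) $P(\phi+1)=P(\phi)[1]$; (2) $\mathrm{Hom}(A,B)=0$ if $A\in P(\phi)$, $B\in P(\psi)$, $\phi>\psi$; (3) for $0\neq E\in P(\phi)$, $Z(\nu[E])=m_\sigma(E)e^{i\pi\phi}$ with $m_\sigma(E)>0$; (4) each $0\neq E\in\mathcal{D}$ has a Harder–Narasimhan filtration, i.e. exact triangles $E_{i-1}\to E_i\to A_i\to E_{i-1}[1]$ ($1\le i\le n$), $E_0=0$, $E_n=E$, with $0\ne A_i\in P(\phi_i)$, $\phi_1>\dots>\phi_n$; (5) (support property) there is $K>0$ with $m_\sigma(E)\ge K\|\nu[E]\|$ for all semistable $E$. For $0\ne E$ put $m_\sigma(E)=\sum_i m_\sigma(A_i)$, $\phi^+_\sigma(E)=\phi_1$, $\phi^-_\sigma(E)=\phi_n$, and $m_{\sigma,t}(E)=\sum_i m_\sigma(A_i)e^{\phi_i t}$ for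 $t\in\mathbb{R}$ (so $m_{\sigma,0}=m_\sigma$); also $m_{\sigma,t}(0)=0$. The set $\mathrm{Stab}_\Lambda(\mathcal{D})$ of stability conditions is topologised by the Bridgeland metric $$d(\sigma,\tau)=\sup_{0\ne E\in\mathcal{D}}\max\left\{\left|\log\tfrac{m_\sigma(E)}{m_\tau(E)}\right|,|\phi^+_\sigma(E)-\phi^+_\tau(E)|,|\phi^-_\sigma(E)-\phi^-_\tau(E)|\right\}$$ (finite on each connected component). $\mathrm{Aut}_\Lambda(\mathcal{D})$ is the group of exact auto-equivalences whose induced action on $K(\mathcal{D})$ descends to an automorphism of $\Lambda$; it acts on the left by isometries via $\alpha\cdot(P,Z)=(\alpha\circ P,Z\circ\alpha^{-1})$. For a specified component $\mathrm{Stab}^\circ_\Lambda(\mathcal{D})$, $\mathrm{Aut}^{\mathrm{o}}_\Lambda(\mathcal{D})$ is the subgroup preserving it. $\mathbb{C}$ acts freely on the right, commuting with auto-equivalences: $(P,Z)\cdot w=(P',e^{-i\pi w}Z)$ with $P'(\phi)=P(\phi+\Re(w))$; so phases decrease by $\Re(w)$ and masses are multiplied by $e^{\pi\Im(w)}$. On the quotient $\mathrm{Stab}^\circ_\Lambda(\mathcal{D})/\mathbb{C}$ use the metric $d(\overline\sigma,\overline\tau)=\inf_{a\in\mathbb{C}}d(\sigma,\tau\cdot a)$; $\alpha$ induces the isometry $\overline\alpha\cdot\overline\sigma=\overline{\alpha\cdot\sigma}$. Mass growth: $h_{\sigma,t}(\alpha)=\sup_{E\in\mathcal{D}}\limsup_{n\to\infty}\frac1n\log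 m_{\sigma,t}(\alpha^nE)$ (with $\log 0=-\infty$). Eventual displacement: for an isometry $\beta$ of a metric space $(X,d)$, $d(\beta)=\lim_{n\to\infty}d(x,\beta^nx)/n$, which exists and is independent of $x\in X$. *)

theory Defs
  imports "HOL-Analysis.Analysis" "HOL-Algebra.Free_Abelian_Groups"
begin

section \<open>Categories, functors, triangulated categories\<close>

record ('o, 'm) cat =
  Ob :: "'o set"
  Arr :: "'m set"
  Src :: "'m \<Rightarrow> 'o"
  Tgt :: "'m \<Rightarrow> 'o"
  Idt :: "'o \<Rightarrow> 'm"
  Comp :: "'m \<Rightarrow> 'm \<Rightarrow> 'm" (infixl "\<cdot>\<index>" 70)

definition Hom :: "('o, 'm, 'x) cat_scheme \<Rightarrow> 'o \<Rightarrow> 'o \<Rightarrow> 'm set" where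
  "Hom C A B = {f \<in> Arr C. Src C f = A \<and> Tgt C f = B}"

locale category =
  fixes C :: "('o, 'm, 'x) cat_scheme" (structure)
  assumes src_tgt: "f \<in> Arr C \<Longrightarrow> Src C f \<in> Ob C \<and> Tgt C f \<in> Ob C"
    and Idt_in: "A \<in> Ob C \<Longrightarrow> Idt C A \<in> Hom C A A"
    and Comp_in: "f \<in> Hom C A B \<Longrightarrow> g \<in> Hom C B E \<Longrightarrow> g \<cdot> f \<in> Hom C A E"
    and Comp_Idt: "f \<in> Hom C A B \<Longrightarrow> f \<cdot> Idt C A = f"
    and Idt_Comp: "f \<in> Hom C A B \<Longrightarrow> Idt C B \<cdot> f = f"
    and Comp_assoc: "f \<in> Hom C A B \<Longrightarrow> g \<in> Hom C B E \<Longrightarrow> h \<in> Hom C E F \<Longrightarrow>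
      h \<cdot> (g \<cdot> f) = (h \<cdot> g) \<cdot> f"

definition iso_arr :: "('o, 'm, 'x) cat_scheme \<Rightarrow> 'o \<Rightarrow> 'o \<Rightarrow> 'm \<Rightarrow> bool" where
  "iso_arr C A B f \<longleftrightarrow> f \<in> Hom C A B \<and>
    (\<exists>g \<in> Hom C B A. g \<cdot>\<^bsub>C\<^esub> f = Idt C A \<and> f \<cdot>\<^bsub>C\<^esub> g = Idt C B)"

definition isomorphic :: "('o, 'm, 'x) cat_scheme \<Rightarrow> 'o \<Rightarrow> 'o \<Rightarrow> bool" where
  "isomorphic C A B \<longleftrightarrow> (\<exists>f. iso_arr C A B f)"

definition iso_closure :: "('o, 'm, 'x) cat_scheme \<Rightarrow> 'o set \<Rightarrow> 'o set" where
  "iso_closure C T = {E \<in> Ob C. \<exists>A \<in> T. isomorphic C A E}"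

record ('o, 'm) endofunctor =
  fob :: "'o \<Rightarrow> 'o"
  farr :: "'m \<Rightarrow> 'm"

definition is_endofunctor :: "('o, 'm, 'x) cat_scheme \<Rightarrow> ('o, 'm) endofunctor \<Rightarrow> bool" where
  "is_endofunctor C F \<longleftrightarrow>
    (\<forall>A \<in> Ob C. fob F A \<in> Ob C \<and> farr F (Idt C A) = Idt C (fob F A)) \<and>
    (\<forall>A B. \<forall>f \<in> Hom C A B. farr F f \<in> Hom C (fob F A) (fob F B)) \<and>
    (\<forall>A B E. \<forall>f \<in> Hom C A B. \<forall>g \<in> Hom C B E. farr F (g \<cdot>\<^bsub>C\<^esub> f) = farr F g \<cdot>\<^bsub>C\<^esub> farr F f)"

definition id_functor :: "('o, 'm) endofunctor" where
  "id_functor = \<lparr>fob = id, farr = id\<rparr>"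

definition comp_functor ::
  "('o, 'm) endofunctor \<Rightarrow> ('o, 'm) endofunctor \<Rightarrow> ('o, 'm) endofunctor" where
  "comp_functor F G = \<lparr>fob = fob F \<circ> fob G, farr = farr F \<circ> farr G\<rparr>"

definition natural_iso :: "('o, 'm, 'x) cat_scheme \<Rightarrow>
    ('o, 'm) endofunctor \<Rightarrow> ('o, 'm) endofunctor \<Rightarrow> ('o \<Rightarrow> 'm) \<Rightarrow> bool" where
  "natural_iso C F G \<eta> \<longleftrightarrow>
    (\<forall>A \<in> Ob C. iso_arr C (fob F A) (fob G A) (\<eta> A)) \<and>
    (\<forall>A B. \<forall>f \<in> Hom C A B. \<eta> B \<cdot>\<^bsub>C\<^esub> farr F f = farr G f \<cdot>\<^bsub>C\<^esub> \<eta> A)"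

definition quasi_inverse :: "('o, 'm, 'x) cat_scheme \<Rightarrow>
    ('o, 'm) endofunctor \<Rightarrow> ('o, 'm) endofunctor \<Rightarrow> bool" where
  "quasi_inverse C F G \<longleftrightarrow> is_endofunctor C G \<and>
    (\<exists>\<eta>. natural_iso C (comp_functor G F) id_functor \<eta>) \<and>
    (\<exists>\<epsilon>. natural_iso C (comp_functor F G) id_functor \<epsilon>)"

definition autoequivalence :: "('o, 'm, 'x) cat_scheme \<Rightarrow> ('o, 'm) endofunctor \<Rightarrow> bool" where
  "autoequivalence C F \<longleftrightarrow> is_endofunctor C F \<and> (\<exists>G. quasi_inverse C F G)"

record ('o, 'm) add_cat = "('o, 'm) cat" +
  Add :: "'m \<Rightarrow> 'm \<Rightarrow> 'm"
  Zero :: "'o \<Rightarrow> 'o \<Rightarrow> 'm"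

definition Hom_group :: "('o, 'm, 'x) add_cat_scheme \<Rightarrow> 'o \<Rightarrow> 'o \<Rightarrow> 'm monoid" where
  "Hom_group C A B = \<lparr>carrier = Hom C A B, monoid.mult = Add C, one = Zero C A B\<rparr>"

definition zero_ob :: "('o, 'm, 'x) cat_scheme \<Rightarrow> 'o \<Rightarrow> bool" where
  "zero_ob C Z \<longleftrightarrow> Z \<in> Ob C \<and>
    (\<forall>A \<in> Ob C. (\<exists>!f. f \<in> Hom C A Z) \<and> (\<exists>!f. f \<in> Hom C Z A))"

definition nonzero_obs :: "('o, 'm, 'x) cat_scheme \<Rightarrow> 'o set" where
  "nonzero_obs C = {E \<in> Ob C. \<not> zero_ob C E}"

definition direct_sum :: "('o, 'm, 'x) add_cat_scheme \<Rightarrow> 'o \<Rightarrow> 'o \<Rightarrow> 'o \<Rightarrow> bool" where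
  "direct_sum C A B S \<longleftrightarrow>
    (\<exists>i \<in> Hom C A S. \<exists>j \<in> Hom C B S. \<exists>p \<in> Hom C S A. \<exists>q \<in> Hom C S B.
      p \<cdot>\<^bsub>C\<^esub> i = Idt C A \<and> q \<cdot>\<^bsub>C\<^esub> j = Idt C B \<and>
      q \<cdot>\<^bsub>C\<^esub> i = Zero C A B \<and> p \<cdot>\<^bsub>C\<^esub> j = Zero C B A \<and>
      Add C (i \<cdot>\<^bsub>C\<^esub> p) (j \<cdot>\<^bsub>C\<^esub> q) = Idt C S)"

locale additive_category = category C
  for C :: "('o, 'm, 'x) add_cat_scheme" (structure) +
  assumes Hom_group: "A \<in> Ob C \<Longrightarrow> B \<in> Ob C \<Longrightarrow> comm_group (Hom_group C A B)"
    and Comp_Add_left: "f \<in> Hom C A B \<Longrightarrow> g \<in> Hom C B E \<Longrightarrow> g' \<in> Hom C B E \<Longrightarrow>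
      Add C g g' \<cdot> f = Add C (g \<cdot> f) (g' \<cdot> f)"
    and Comp_Add_right: "f \<in> Hom C A B \<Longrightarrow> f' \<in> Hom C A B \<Longrightarrow> g \<in> Hom C B E \<Longrightarrow>
      g \<cdot> Add C f f' = Add C (g \<cdot> f) (g \<cdot> f')"
    and ex_zero_ob: "\<exists>Z. zero_ob C Z"
    and ex_direct_sum: "A \<in> Ob C \<Longrightarrow> B \<in> Ob C \<Longrightarrow> \<exists>S \<in> Ob C. direct_sum C A B S"

definition additive_functor :: "('o, 'm, 'x) add_cat_scheme \<Rightarrow> ('o, 'm) endofunctor \<Rightarrow> bool" where
  "additive_functor C F \<longleftrightarrow> is_endofunctor C F \<and>
    (\<forall>A B. \<forall>f \<in> Hom C A B. \<forall>g \<in> Hom C A B. farr F (Add C f g) = Add C (farr F f) (farr F g))"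

text \<open>A triple \<open>(f, g, h)\<close> in \<open>Tri\<close> stands for the exact triangle
  \<open>X \<rightarrow> Y \<rightarrow> Z \<rightarrow> X[1]\<close> with arrows \<open>f\<close>, \<open>g\<close>, \<open>h\<close>.\<close>

record ('o, 'm) tri_cat = "('o, 'm) add_cat" +
  Shift :: "('o, 'm) endofunctor"
  Tri :: "('m \<times> 'm \<times> 'm) set"

abbreviation sh_ob :: "('o, 'm, 'x) tri_cat_scheme \<Rightarrow> 'o \<Rightarrow> 'o" where
  "sh_ob D \<equiv> fob (Shift D)"

abbreviation sh_arr :: "('o, 'm, 'x) tri_cat_scheme \<Rightarrow> 'm \<Rightarrow> 'm" where
  "sh_arr D \<equiv> farr (Shift D)"

definition candidate :: "('o, 'm, 'x) tri_cat_scheme \<Rightarrow> 'o \<Rightarrow> 'o \<Rightarrow> 'o \<Rightarrow> 'm \<times> 'm \<times> 'm \<Rightarrow> bool" where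
  "candidate D X Y Z t \<longleftrightarrow> (case t of (f, g, h) \<Rightarrow>
    f \<in> Hom D X Y \<and> g \<in> Hom D Y Z \<and> h \<in> Hom D Z (sh_ob D X))"

definition triangle :: "('o, 'm, 'x) tri_cat_scheme \<Rightarrow> 'o \<Rightarrow> 'o \<Rightarrow> 'o \<Rightarrow> 'm \<times> 'm \<times> 'm \<Rightarrow> bool" where
  "triangle D X Y Z t \<longleftrightarrow> candidate D X Y Z t \<and> t \<in> Tri D"

text \<open>The shift is only required to be an auto-equivalence, not an automorphism; this is why
  rotation is stated as an equivalence.  The last axiom is the octahedral axiom.\<close>

locale triangulated_category = additive_category D
  for D :: "('o, 'm, 'x) tri_cat_scheme" (structure) +
  assumes Shift_equiv: "autoequivalence D (Shift D)"
    and Shift_additive: "additive_functor D (Shift D)"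
    and Tri_candidate: "t \<in> Tri D \<Longrightarrow> \<exists>X Y Z. candidate D X Y Z t"
    and Tri_id: "X \<in> Ob D \<Longrightarrow> zero_ob D Z \<Longrightarrow>
      (Idt D X, Zero D X Z, Zero D Z (sh_ob D X)) \<in> Tri D"
    and Tri_iso: "triangle D X Y Z (f, g, h) \<Longrightarrow> candidate D X' Y' Z' (f', g', h') \<Longrightarrow>
      iso_arr D X X' u \<Longrightarrow> iso_arr D Y Y' v \<Longrightarrow> iso_arr D Z Z' w \<Longrightarrow>
      v \<cdot> f = f' \<cdot> u \<Longrightarrow> w \<cdot> g = g' \<cdot> v \<Longrightarrow> sh_arr D u \<cdot> h = h' \<cdot> w \<Longrightarrow>
      (f', g', h') \<in> Tri D"
    and Tri_ex: "f \<in> Hom D X Y \<Longrightarrow> \<exists>Z g h. triangle D X Y Z (f, g, h)"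
    and Tri_rotate: "candidate D X Y Z (f, g, h) \<Longrightarrow>
      (f, g, h) \<in> Tri D \<longleftrightarrow>
      (g, h, inv\<^bsub>Hom_group D (sh_ob D X) (sh_ob D Y)\<^esub> (sh_arr D f)) \<in> Tri D"
    and Tri_morphism: "triangle D X Y Z (f, g, h) \<Longrightarrow> triangle D X' Y' Z' (f', g', h') \<Longrightarrow>
      u \<in> Hom D X X' \<Longrightarrow> v \<in> Hom D Y Y' \<Longrightarrow> v \<cdot> f = f' \<cdot> u \<Longrightarrow>
      \<exists>w \<in> Hom D Z Z'. w \<cdot> g = g' \<cdot> v \<and> sh_arr D u \<cdot> h = h' \<cdot> w"
    and Tri_octahedron: "triangle D X Y Z' (f, a, b) \<Longrightarrow> triangle D Y Z X' (g, k, l) \<Longrightarrow>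
      triangle D X Z Y' (g \<cdot> f, c, d) \<Longrightarrow>
      \<exists>u v. triangle D Z' Y' X' (u, v, sh_arr D a \<cdot> l) \<and>
        u \<cdot> a = c \<cdot> g \<and> d \<cdot> u = b \<and> v \<cdot> c = k \<and> l \<cdot> v = sh_arr D f \<cdot> d"

definition exact_functor :: "('o, 'm, 'x) tri_cat_scheme \<Rightarrow> ('o, 'm) endofunctor \<Rightarrow> bool" where
  "exact_functor D F \<longleftrightarrow> additive_functor D F \<and>
    (\<exists>\<eta>. natural_iso D (comp_functor F (Shift D)) (comp_functor (Shift D) F) \<eta> \<and>
      (\<forall>X Y Z f g h. triangle D X Y Z (f, g, h) \<longrightarrow>
        (farr F f, farr F g, \<eta> X \<cdot>\<^bsub>D\<^esub> farr F h) \<in> Tri D))"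

text \<open>Full subcategories are identified with their sets of objects and are taken to be closed
  under isomorphism.\<close>

definition additive_subcat :: "('o, 'm, 'x) add_cat_scheme \<Rightarrow> 'o set \<Rightarrow> bool" where
  "additive_subcat C T \<longleftrightarrow> T \<subseteq> Ob C \<and> iso_closure C T = T \<and> (\<forall>Z. zero_ob C Z \<longrightarrow> Z \<in> T) \<and>
    (\<forall>A \<in> T. \<forall>B \<in> T. \<forall>S \<in> Ob C. direct_sum C A B S \<longrightarrow> S \<in> T)"

definition thick_subcat :: "('o, 'm, 'x) tri_cat_scheme \<Rightarrow> 'o set \<Rightarrow> bool" where
  "thick_subcat D T \<longleftrightarrow> additive_subcat D T \<and>
    (\<forall>A \<in> Ob D. sh_ob D A \<in> T \<longleftrightarrow> A \<in> T) \<and>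
    (\<forall>X Y Z t. triangle D X Y Z t \<and> X \<in> T \<and> Y \<in> T \<longrightarrow> Z \<in> T) \<and>
    (\<forall>A \<in> Ob D. \<forall>B \<in> Ob D. \<forall>S \<in> T. direct_sum D A B S \<longrightarrow> A \<in> T)"

definition thick_closure :: "('o, 'm, 'x) tri_cat_scheme \<Rightarrow> 'o set \<Rightarrow> 'o set" where
  "thick_closure D M = \<Inter> {T. thick_subcat D T \<and> M \<subseteq> T}"

definition split_generator :: "('o, 'm, 'x) tri_cat_scheme \<Rightarrow> 'o \<Rightarrow> bool" where
  "split_generator D G \<longleftrightarrow> G \<in> Ob D \<and> thick_closure D {G} = Ob D"

section \<open>Grothendieck group and lattice\<close>

definition K0_relations :: "('o, 'm, 'x) tri_cat_scheme \<Rightarrow> ('o \<Rightarrow>\<^sub>0 int) set" where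
  "K0_relations D = generate (free_Abelian_group (Ob D))
    {frag_of Y - frag_of X - frag_of Z | X Y Z. \<exists>t. triangle D X Y Z t}"

definition K0 :: "('o, 'm, 'x) tri_cat_scheme \<Rightarrow> ('o \<Rightarrow>\<^sub>0 int) set monoid" where
  "K0 D = free_Abelian_group (Ob D) Mod K0_relations D"

definition K0_class :: "('o, 'm, 'x) tri_cat_scheme \<Rightarrow> 'o \<Rightarrow> ('o \<Rightarrow>\<^sub>0 int) set" where
  "K0_class D E = K0_relations D #>\<^bsub>free_Abelian_group (Ob D)\<^esub> frag_of E"

definition add_group :: "'v::ab_group_add set \<Rightarrow> 'v monoid" where
  "add_group A = \<lparr>carrier = A, monoid.mult = (+), one = 0\<rparr>"

text \<open>A lattice \<open>\<Lambda>\<close> of finite rank is realised inside a real vector space as the integral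
  combinations of a finite linearly independent set, so that \<open>\<Lambda> \<otimes> \<real>\<close> is \<open>span \<Lambda>\<close>.\<close>

definition finite_rank_lattice :: "'v::real_vector set \<Rightarrow> bool" where
  "finite_rank_lattice \<Lambda> \<longleftrightarrow> (\<exists>B. finite B \<and> independent B \<and>
    \<Lambda> = {(\<Sum>b\<in>B. of_int (c b) *\<^sub>R b) | c :: 'v \<Rightarrow> int. True})"

definition norm_on :: "'v::real_vector set \<Rightarrow> ('v \<Rightarrow> real) \<Rightarrow> bool" where
  "norm_on V N \<longleftrightarrow>
    (\<forall>x \<in> V. 0 \<le> N x \<and> (N x = 0 \<longleftrightarrow> x = 0)) \<and>
    (\<forall>x \<in> V. \<forall>r. N (r *\<^sub>R x) = \<bar>r\<bar> * N x) \<and>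
    (\<forall>x \<in> V. \<forall>y \<in> V. N (x + y) \<le> N x + N y)"

section \<open>Stability conditions\<close>

record ('o, 'v) stab =
  Slice :: "real \<Rightarrow> 'o set"
  Charge :: "'v \<Rightarrow> complex"

text \<open>A Harder--Narasimhan filtration of \<open>E\<close>, recorded by the list of its factors together
  with their phases.\<close>

definition HN_filtration ::
  "('o, 'm, 'x) tri_cat_scheme \<Rightarrow> (real \<Rightarrow> 'o set) \<Rightarrow> 'o \<Rightarrow> ('o \<times> real) list \<Rightarrow> bool" where
  "HN_filtration D P E xs \<longleftrightarrow>
    (\<exists>Es :: nat \<Rightarrow> 'o. zero_ob D (Es 0) \<and> Es (length xs) = E \<and>
      (\<forall>i < length xs. \<exists>t. triangle D (Es i) (Es (Suc i)) (fst (xs ! i)) t)) \<and>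
    (\<forall>(A, \<phi>) \<in> set xs. A \<in> P \<phi> \<and> \<not> zero_ob D A) \<and>
    sorted_wrt (>) (map snd xs)"

text \<open>The central charge is normalised to be \<open>undefined\<close> off \<open>\<Lambda>\<close>, so that stability conditions
  are equal as soon as their slicings and their charges on \<open>\<Lambda>\<close> are.  The mass of a semistable
  object is the modulus of its charge.\<close>

definition stability_condition :: "('o, 'm, 'x) tri_cat_scheme \<Rightarrow>
    (('o \<Rightarrow>\<^sub>0 int) set \<Rightarrow> 'v::real_vector) \<Rightarrow> 'v set \<Rightarrow> ('v \<Rightarrow> real) \<Rightarrow> ('o, 'v) stab \<Rightarrow> bool" where
  "stability_condition D \<nu> \<Lambda> N \<sigma> \<longleftrightarrow>
    Charge \<sigma> \<in> hom (add_group \<Lambda>) (add_group UNIV) \<and> Charge \<sigma> \<in> extensional \<Lambda> \<and>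
    (\<forall>\<phi>. additive_subcat D (Slice \<sigma> \<phi>)) \<and>
    (\<forall>\<phi>. Slice \<sigma> (\<phi> + 1) = iso_closure D (sh_ob D ` Slice \<sigma> \<phi>)) \<and>
    (\<forall>\<phi> \<psi>. \<forall>A \<in> Slice \<sigma> \<phi>. \<forall>B \<in> Slice \<sigma> \<psi>. \<phi> > \<psi> \<longrightarrow> Hom D A B = {Zero D A B}) \<and>
    (\<forall>\<phi>. \<forall>E \<in> Slice \<sigma> \<phi> \<inter> nonzero_obs D. \<exists>m > 0.
      Charge \<sigma> (\<nu> (K0_class D E)) = of_real m * exp (\<i> * of_real (pi * \<phi>))) \<and>
    (\<forall>E \<in> nonzero_obs D. \<exists>xs. HN_filtration D (Slice \<sigma>) E xs) \<and>
    (\<exists>K > 0. \<forall>\<phi>. \<forall>E \<in> Slice \<sigma> \<phi> \<inter> nonzero_obs D.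
      cmod (Charge \<sigma> (\<nu> (K0_class D E))) \<ge> K * N (\<nu> (K0_class D E)))"

definition Stab :: "('o, 'm, 'x) tri_cat_scheme \<Rightarrow>
    (('o \<Rightarrow>\<^sub>0 int) set \<Rightarrow> 'v::real_vector) \<Rightarrow> 'v set \<Rightarrow> ('v \<Rightarrow> real) \<Rightarrow> ('o, 'v) stab set" where
  "Stab D \<nu> \<Lambda> N = Collect (stability_condition D \<nu> \<Lambda> N)"

text \<open>The Harder--Narasimhan filtration is unique up to isomorphism, so none of the quantities
  below depends on the choice.\<close>

definition HN :: "('o, 'm, 'x) tri_cat_scheme \<Rightarrow> ('o, 'v) stab \<Rightarrow> 'o \<Rightarrow> ('o \<times> real) list" where
  "HN D \<sigma> E = (SOME xs. HN_filtration D (Slice \<sigma>) E xs)"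

definition mass_t :: "('o, 'm, 'x) tri_cat_scheme \<Rightarrow> (('o \<Rightarrow>\<^sub>0 int) set \<Rightarrow> 'v) \<Rightarrow>
    ('o, 'v) stab \<Rightarrow> real \<Rightarrow> 'o \<Rightarrow> real" where
  "mass_t D \<nu> \<sigma> t E = (if zero_ob D E then 0 else
    (\<Sum>(A, \<phi>) \<leftarrow> HN D \<sigma> E. cmod (Charge \<sigma> (\<nu> (K0_class D A))) * exp (\<phi> * t)))"

abbreviation mass :: "('o, 'm, 'x) tri_cat_scheme \<Rightarrow> (('o \<Rightarrow>\<^sub>0 int) set \<Rightarrow> 'v) \<Rightarrow>
    ('o, 'v) stab \<Rightarrow> 'o \<Rightarrow> real" where
  "mass D \<nu> \<sigma> E \<equiv> mass_t D \<nu> \<sigma> 0 E"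

definition phase_max :: "('o, 'm, 'x) tri_cat_scheme \<Rightarrow> ('o, 'v) stab \<Rightarrow> 'o \<Rightarrow> real" where
  "phase_max D \<sigma> E = snd (hd (HN D \<sigma> E))"

definition phase_min :: "('o, 'm, 'x) tri_cat_scheme \<Rightarrow> ('o, 'v) stab \<Rightarrow> 'o \<Rightarrow> real" where
  "phase_min D \<sigma> E = snd (last (HN D \<sigma> E))"

definition stab_dist :: "('o, 'm, 'x) tri_cat_scheme \<Rightarrow> (('o \<Rightarrow>\<^sub>0 int) set \<Rightarrow> 'v) \<Rightarrow>
    ('o, 'v) stab \<Rightarrow> ('o, 'v) stab \<Rightarrow> ereal" where
  "stab_dist D \<nu> \<sigma> \<tau> = (SUP E \<in> nonzero_obs D. ereal (Max
    {\<bar>ln (mass D \<nu> \<sigma> E / mass D \<nu> \<tau> E)\<bar>,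
     \<bar>phase_max D \<sigma> E - phase_max D \<tau> E\<bar>,
     \<bar>phase_min D \<sigma> E - phase_min D \<tau> E\<bar>}))"

text \<open>The distance may be infinite; the metric topology is generated by the open balls.\<close>

definition stab_topology :: "('o, 'm, 'x) tri_cat_scheme \<Rightarrow>
    (('o \<Rightarrow>\<^sub>0 int) set \<Rightarrow> 'v::real_vector) \<Rightarrow> 'v set \<Rightarrow> ('v \<Rightarrow> real) \<Rightarrow> ('o, 'v) stab topology" where
  "stab_topology D \<nu> \<Lambda> N = topology_generated_by
    {{\<tau> \<in> Stab D \<nu> \<Lambda> N. stab_dist D \<nu> \<sigma> \<tau> < ereal r} | \<sigma> r. \<sigma> \<in> Stab D \<nu> \<Lambda> N \<and> r > 0}"

section \<open>Group actions and the quotient by \<open>\<complex>\<close>\<close>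

text \<open>The automorphism of \<open>\<Lambda>\<close> to which the action of \<open>F\<close> on the Grothendieck group descends.\<close>

definition descends_to :: "('o, 'm, 'x) tri_cat_scheme \<Rightarrow>
    (('o \<Rightarrow>\<^sub>0 int) set \<Rightarrow> 'v::real_vector) \<Rightarrow> 'v set \<Rightarrow>
    ('o, 'm) endofunctor \<Rightarrow> ('v \<Rightarrow> 'v) \<Rightarrow> bool" where
  "descends_to D \<nu> \<Lambda> F a \<longleftrightarrow> a \<in> iso (add_group \<Lambda>) (add_group \<Lambda>) \<and> a \<in> extensional \<Lambda> \<and>
    (\<exists>k \<in> hom (K0 D) (K0 D). (\<forall>E \<in> Ob D. k (K0_class D E) = K0_class D (fob F E)) \<and>
      (\<forall>x \<in> carrier (K0 D). a (\<nu> x) = \<nu> (k x)))"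

definition lattice_action :: "('o, 'm, 'x) tri_cat_scheme \<Rightarrow>
    (('o \<Rightarrow>\<^sub>0 int) set \<Rightarrow> 'v::real_vector) \<Rightarrow> 'v set \<Rightarrow> ('o, 'm) endofunctor \<Rightarrow> 'v \<Rightarrow> 'v" where
  "lattice_action D \<nu> \<Lambda> F = (THE a. descends_to D \<nu> \<Lambda> F a)"

text \<open>Auto-equivalences are represented by actual functors rather than by their classes up to
  natural isomorphism; naturally isomorphic functors act in the same way.\<close>

definition Aut :: "('o, 'm, 'x) tri_cat_scheme \<Rightarrow>
    (('o \<Rightarrow>\<^sub>0 int) set \<Rightarrow> 'v::real_vector) \<Rightarrow> 'v set \<Rightarrow> ('o, 'm) endofunctor set" where
  "Aut D \<nu> \<Lambda> = {F. exact_functor D F \<and> autoequivalence D F \<and> (\<exists>a. descends_to D \<nu> \<Lambda> F a)}"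

definition aut_act :: "('o, 'm, 'x) tri_cat_scheme \<Rightarrow>
    (('o \<Rightarrow>\<^sub>0 int) set \<Rightarrow> 'v::real_vector) \<Rightarrow> 'v set \<Rightarrow>
    ('o, 'm) endofunctor \<Rightarrow> ('o, 'v) stab \<Rightarrow> ('o, 'v) stab" where
  "aut_act D \<nu> \<Lambda> F \<sigma> =
    \<lparr>Slice = (\<lambda>\<phi>. iso_closure D (fob F ` Slice \<sigma> \<phi>)),
     Charge = restrict (Charge \<sigma> \<circ> inv_into \<Lambda> (lattice_action D \<nu> \<Lambda> F)) \<Lambda>\<rparr>"

definition Aut_component :: "('o, 'm, 'x) tri_cat_scheme \<Rightarrow>
    (('o \<Rightarrow>\<^sub>0 int) set \<Rightarrow> 'v::real_vector) \<Rightarrow> 'v set \<Rightarrow>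
    ('o, 'v) stab set \<Rightarrow> ('o, 'm) endofunctor set" where
  "Aut_component D \<nu> \<Lambda> S = {F \<in> Aut D \<nu> \<Lambda>. aut_act D \<nu> \<Lambda> F ` S = S}"

definition c_act :: "'v::real_vector set \<Rightarrow> ('o, 'v) stab \<Rightarrow> complex \<Rightarrow> ('o, 'v) stab" where
  "c_act \<Lambda> \<sigma> w =
    \<lparr>Slice = (\<lambda>\<phi>. Slice \<sigma> (\<phi> + Re w)),
     Charge = restrict (\<lambda>x. exp (- \<i> * of_real pi * w) * Charge \<sigma> x) \<Lambda>\<rparr>"

definition c_orbit :: "'v::real_vector set \<Rightarrow> ('o, 'v) stab \<Rightarrow> ('o, 'v) stab set" where
  "c_orbit \<Lambda> \<sigma> = range (c_act \<Lambda> \<sigma>)"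

definition quot :: "'v::real_vector set \<Rightarrow> ('o, 'v) stab set \<Rightarrow> ('o, 'v) stab set set" where
  "quot \<Lambda> S = c_orbit \<Lambda> ` S"

text \<open>\<open>\<complex>\<close> acts by isometries, so the choice of representatives of the orbits is immaterial.\<close>

definition quot_dist :: "('o, 'm, 'x) tri_cat_scheme \<Rightarrow>
    (('o \<Rightarrow>\<^sub>0 int) set \<Rightarrow> 'v::real_vector) \<Rightarrow> 'v set \<Rightarrow>
    ('o, 'v) stab set \<Rightarrow> ('o, 'v) stab set \<Rightarrow> ereal" where
  "quot_dist D \<nu> \<Lambda> X Y =
    (INF a. stab_dist D \<nu> (SOME \<sigma>. \<sigma> \<in> X) (c_act \<Lambda> (SOME \<tau>. \<tau> \<in> Y) a))"

text \<open>Since the two actions commute, the image of the orbit of \<open>\<sigma>\<close> is the orbit of the image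
  of \<open>\<sigma>\<close>.\<close>

definition quot_act :: "('o, 'm, 'x) tri_cat_scheme \<Rightarrow>
    (('o \<Rightarrow>\<^sub>0 int) set \<Rightarrow> 'v::real_vector) \<Rightarrow> 'v set \<Rightarrow>
    ('o, 'm) endofunctor \<Rightarrow> ('o, 'v) stab set \<Rightarrow> ('o, 'v) stab set" where
  "quot_act D \<nu> \<Lambda> F X = aut_act D \<nu> \<Lambda> F ` X"

section \<open>Mass growth and eventual displacement\<close>

definition elog :: "real \<Rightarrow> ereal" where
  "elog x = (if x = 0 then - \<infinity> else ereal (ln x))"

definition mass_growth :: "('o, 'm, 'x) tri_cat_scheme \<Rightarrow> (('o \<Rightarrow>\<^sub>0 int) set \<Rightarrow> 'v) \<Rightarrow>
    ('o, 'v) stab \<Rightarrow> real \<Rightarrow> ('o, 'm) endofunctor \<Rightarrow> ereal" where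
  "mass_growth D \<nu> \<sigma> t F = (SUP E \<in> Ob D.
    limsup (\<lambda>n. elog (mass_t D \<nu> \<sigma> t ((fob F ^^ n) E)) / ereal (real n)))"

text \<open>For an isometry of a non-empty metric space the limit exists and is the same for all
  base points.\<close>

definition eventual_displacement :: "'a set \<Rightarrow> ('a \<Rightarrow> 'a \<Rightarrow> ereal) \<Rightarrow> ('a \<Rightarrow> 'a) \<Rightarrow> ereal" where
  "eventual_displacement X d f =
    (THE l. \<forall>x \<in> X. (\<lambda>n. d x ((f ^^ n) x) / ereal (real n)) \<longlonglongrightarrow> l)"

end

theory Submission
  imports Defs
begin

text \<open>
  Fix \<open>n \<ge> 1\<close> and \<open>a \<in> \<complex>\<close>, and let \<open>d = d(\<sigma>, \<alpha>\<^sup>n\<sigma> \<cdot> a)\<close>.  Comparing the masses of the single object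
  \<open>\<alpha>\<^sup>k\<^sup>+\<^sup>nE\<close> gives \<open>ln m\<^sub>\<sigma>(\<alpha>\<^sup>k\<^sup>+\<^sup>nE) \<le> ln m\<^sub>\<sigma>(\<alpha>\<^sup>kE) + d + \<pi> Im a\<close> for every \<open>k\<close>, and comparing those of
  \<open>\<alpha>\<^sup>-\<^sup>kE\<close> gives the same bound for \<open>\<alpha>\<inverse>\<close> with \<open>d - \<pi> Im a\<close>.  Hence the two growth rates are at most
  \<open>(d + \<pi> Im a)/n\<close> and \<open>(d - \<pi> Im a)/n\<close>, so their mean is at most \<open>d/n\<close>; now take the infimum over
  \<open>a\<close> and let \<open>n \<rightarrow> \<infinity>\<close>.  Masses and phases are well defined because Harder--Narasimhan filtrations
  are unique, and the limit exists by Fekete's argument, distances being finite on a component because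
  the points at finite distance from a given one form a clopen set.
\<close>

section \<open>Categories and additive categories\<close>

text \<open>Much of the length pays for choices inside the definitions: \<open>HN\<close>, the
  representatives in \<open>quot_dist\<close>, \<open>lattice_action\<close> and
  \<open>eventual_displacement\<close> are picked by description operators, so nothing can be
  estimated before their values are identified. The hard case is \<open>HN\<close>. Fill-in
  morphisms between triangles are not unique, and neither are factorisations through a cone. If
  \<open>X\<close> is the last step before \<open>E\<close> and \<open>A\<close> the last factor,
  the way out is that Hom into \<open>A\<close> vanishes both on the earlier step of the competing
  filtration and on the shift of \<open>X\<close>: the first produces comparison maps between the
  last factors, the second makes them mutually inverse. The earlier steps are then compared through
  cones, where a round trip of two fill-ins has the form 1 + n with n n = 0 and is therefore
  invertible. The other obstacle is to get by with little structure. The quasi-inverse is never made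
  to act on stability conditions; its growth is read off from applying \<open>\<alpha>\<close> n
  times after n further steps of \<open>\<alpha>_inv\<close>. Likewise translates by complex numbers
  enter only through their explicitly computed masses and phases.\<close>

context category
begin

lemma Hom_Ob: "f \<in> Hom C A B \<Longrightarrow> A \<in> Ob C" "f \<in> Hom C A B \<Longrightarrow> B \<in> Ob C"
  using src_tgt by (auto simp: Hom_def)

lemma iso_arr_Ob: "iso_arr C A B f \<Longrightarrow> A \<in> Ob C" "iso_arr C A B f \<Longrightarrow> B \<in> Ob C"
  unfolding iso_arr_def using Hom_Ob by blast+

lemma iso_arr_Idt: "A \<in> Ob C \<Longrightarrow> iso_arr C A A (Idt C A)"
  unfolding iso_arr_def using Idt_in Comp_Idt by blast

lemma iso_arrE:
  assumes "iso_arr C A B f"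
  obtains g where "f \<in> Hom C A B" "g \<in> Hom C B A" "g \<cdot> f = Idt C A" "f \<cdot> g = Idt C B"
    "iso_arr C B A g"
  using assms unfolding iso_arr_def by blast

lemma isomorphic_refl: "A \<in> Ob C \<Longrightarrow> isomorphic C A A"
  unfolding isomorphic_def using iso_arr_Idt by blast

lemma isomorphic_sym: "isomorphic C A B \<Longrightarrow> isomorphic C B A"
  unfolding isomorphic_def by (meson iso_arrE)

lemma Comp_cancel_middle:
  assumes "f \<in> Hom C A B" "g \<in> Hom C B E" "g' \<in> Hom C E B" "f' \<in> Hom C B A"
    and "g' \<cdot> g = Idt C B"
  shows "(f' \<cdot> g') \<cdot> (g \<cdot> f) = f' \<cdot> f"
proof -
  have "(f' \<cdot> g') \<cdot> (g \<cdot> f) = f' \<cdot> (g' \<cdot> (g \<cdot> f))"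
    using assms Comp_in Comp_assoc[of "g \<cdot> f" A E g' B f' A] by simp
  also have "g' \<cdot> (g \<cdot> f) = (g' \<cdot> g) \<cdot> f"
    using assms Comp_assoc by blast
  finally show ?thesis using assms Idt_Comp by simp
qed

lemma iso_arr_Comp:
  assumes "iso_arr C A B f" "iso_arr C B E g"
  shows "iso_arr C A E (g \<cdot> f)"
proof -
  obtain f' where f: "f \<in> Hom C A B" "f' \<in> Hom C B A" "f' \<cdot> f = Idt C A" "f \<cdot> f' = Idt C B"
    using assms(1) by (rule iso_arrE)
  obtain g' where g: "g \<in> Hom C B E" "g' \<in> Hom C E B" "g' \<cdot> g = Idt C B" "g \<cdot> g' = Idt C E"
    using assms(2) by (rule iso_arrE)
  have "(f' \<cdot> g') \<cdot> (g \<cdot> f) = Idt C A" "(g \<cdot> f) \<cdot> (f' \<cdot> g') = Idt C E"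
    using f g Comp_cancel_middle[of f A B g E g' f'] Comp_cancel_middle[of g' E B f' A f g] by auto
  then show ?thesis unfolding iso_arr_def using f g Comp_in by blast
qed

lemma isomorphic_trans: "isomorphic C A B \<Longrightarrow> isomorphic C B E \<Longrightarrow> isomorphic C A E"
  unfolding isomorphic_def using iso_arr_Comp by blast

lemma isomorphic_Ob: "isomorphic C A B \<Longrightarrow> A \<in> Ob C" "isomorphic C A B \<Longrightarrow> B \<in> Ob C"
  unfolding isomorphic_def using iso_arr_Ob by blast+

lemma iso_arrI_left_right:
  assumes w: "w \<in> Hom C A B" and l: "l \<in> Hom C B A" "l \<cdot> w = Idt C A"
    and r: "r \<in> Hom C B A" "w \<cdot> r = Idt C B"
  shows "iso_arr C A B w"
proof -
  have "l = l \<cdot> (w \<cdot> r)" using l r Comp_Idt by simp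
  also have "\<dots> = (l \<cdot> w) \<cdot> r" using w l r Comp_assoc by blast
  also have "\<dots> = r" using l r Idt_Comp by simp
  finally show ?thesis using assms unfolding iso_arr_def by auto
qed

lemma functor_iso_arr:
  assumes F: "is_endofunctor C F" and f: "iso_arr C A B f"
  shows "iso_arr C (fob F A) (fob F B) (farr F f)"
proof -
  obtain g where g: "f \<in> Hom C A B" "g \<in> Hom C B A" "g \<cdot> f = Idt C A" "f \<cdot> g = Idt C B"
    using f by (rule iso_arrE)
  then have "farr F g \<cdot> farr F f = Idt C (fob F A)" "farr F f \<cdot> farr F g = Idt C (fob F B)"
    using F Hom_Ob unfolding is_endofunctor_def by metis+
  with g F show ?thesis unfolding is_endofunctor_def iso_arr_def by blast
qed

lemma functor_isomorphic:
  "is_endofunctor C F \<Longrightarrow> isomorphic C A B \<Longrightarrow> isomorphic C (fob F A) (fob F B)"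
  using functor_iso_arr unfolding isomorphic_def by blast

lemma functor_Ob: "is_endofunctor C F \<Longrightarrow> A \<in> Ob C \<Longrightarrow> fob F A \<in> Ob C"
  unfolding is_endofunctor_def by blast

lemma quasi_inverse_isomorphic:
  assumes "quasi_inverse C F H" "A \<in> Ob C"
  shows "isomorphic C (fob H (fob F A)) A" "isomorphic C (fob F (fob H A)) A"
  using assms unfolding quasi_inverse_def natural_iso_def isomorphic_def
  by (auto simp: comp_functor_def id_functor_def)

text \<open>Apply a quasi-inverse to both sides. Needed above all for the shift, which is invertible
  only up to isomorphism: it turns an isomorphism of X[1] and Y[1] into one of X and Y.\<close>

lemma autoequivalence_isomorphicD:
  assumes "autoequivalence C F" "A \<in> Ob C" "B \<in> Ob C" "isomorphic C (fob F A) (fob F B)"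
  shows "isomorphic C A B"
proof -
  obtain H where H: "quasi_inverse C F H" using assms unfolding autoequivalence_def by blast
  then have "isomorphic C (fob H (fob F A)) (fob H (fob F B))"
    using assms functor_isomorphic unfolding quasi_inverse_def by blast
  then show ?thesis using quasi_inverse_isomorphic[OF H] assms isomorphic_sym isomorphic_trans by meson
qed

end

context additive_category
begin

lemma Zero_in: "A \<in> Ob C \<Longrightarrow> B \<in> Ob C \<Longrightarrow> Zero C A B \<in> Hom C A B"
  using Hom_group[THEN comm_group.axioms(2), THEN group.is_monoid, THEN monoid.one_closed]
  by (simp add: Hom_group_def)

lemma
  assumes f: "f \<in> Hom C A B"
  shows Add_in: "g \<in> Hom C A B \<Longrightarrow> Add C f g \<in> Hom C A B"
    and Add_Zero: "Add C f (Zero C A B) = f"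
    and Zero_Add: "Add C (Zero C A B) f = f"
    and Add_assoc: "g \<in> Hom C A B \<Longrightarrow> h \<in> Hom C A B \<Longrightarrow>
      Add C (Add C f g) h = Add C f (Add C g h)"
proof -
  interpret comm_group "Hom_group C A B" using Hom_group Hom_Ob f by blast
  show "g \<in> Hom C A B \<Longrightarrow> Add C f g \<in> Hom C A B" "Add C f (Zero C A B) = f"
    "Add C (Zero C A B) f = f"
    "g \<in> Hom C A B \<Longrightarrow> h \<in> Hom C A B \<Longrightarrow> Add C (Add C f g) h = Add C f (Add C g h)"
    using m_closed[of f g] r_one[of f] l_one[of f] m_assoc[of f g h] f
    by (simp_all add: Hom_group_def)
qed

lemma neg_ex:
  assumes f: "f \<in> Hom C A B"
  shows "inv\<^bsub>Hom_group C A B\<^esub> f \<in> Hom C A B"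
    "Add C f (inv\<^bsub>Hom_group C A B\<^esub> f) = Zero C A B" "Add C (inv\<^bsub>Hom_group C A B\<^esub> f) f = Zero C A B"
proof -
  interpret comm_group "Hom_group C A B" using Hom_group Hom_Ob f by blast
  have "f \<in> carrier (Hom_group C A B)" using f by (simp add: Hom_group_def)
  from inv_closed[OF this] r_inv[OF this] l_inv[OF this]
  show "inv\<^bsub>Hom_group C A B\<^esub> f \<in> Hom C A B"
    "Add C f (inv\<^bsub>Hom_group C A B\<^esub> f) = Zero C A B" "Add C (inv\<^bsub>Hom_group C A B\<^esub> f) f = Zero C A B"
    by (simp_all add: Hom_group_def)
qed

lemma Add_cancel_Zero:
  assumes f: "f \<in> Hom C A B" and g: "g \<in> Hom C A B" and "Add C f g = f"
  shows "g = Zero C A B"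
proof -
  define f' where "f' = inv\<^bsub>Hom_group C A B\<^esub> f"
  have f': "f' \<in> Hom C A B" "Add C f' f = Zero C A B" using neg_ex[OF f] unfolding f'_def by auto
  have "g = Add C (Add C f' f) g" using f' Zero_Add[OF g] by simp
  also have "\<dots> = Add C f' f" using Add_assoc[OF f'(1) f g] assms(3) by simp
  finally show ?thesis using f' by simp
qed

lemma Add_diff_ex:
  assumes f: "f \<in> Hom C A B" and g: "g \<in> Hom C A B"
  shows "\<exists>d \<in> Hom C A B. f = Add C g d"
proof -
  define g' where "g' = inv\<^bsub>Hom_group C A B\<^esub> g"
  have g': "g' \<in> Hom C A B" "Add C g g' = Zero C A B" using neg_ex[OF g] unfolding g'_def by auto
  have "f = Add C g (Add C g' f)" using Add_assoc[OF g g'(1) f] g' Zero_Add[OF f] by simp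
  then show ?thesis using Add_in[OF g'(1) f] by blast
qed

lemma Zero_Comp:
  assumes f: "f \<in> Hom C A B" and E: "E \<in> Ob C"
  shows "Zero C B E \<cdot> f = Zero C A E"
proof -
  have Z: "Zero C B E \<in> Hom C B E" using Zero_in E Hom_Ob f by blast
  show ?thesis
    using Add_cancel_Zero[of "Zero C B E \<cdot> f" A E] Comp_Add_left[OF f Z Z] Add_Zero[OF Z] Comp_in[OF f Z]
    by simp
qed

lemma Comp_Zero:
  assumes f: "f \<in> Hom C B E" and A: "A \<in> Ob C"
  shows "f \<cdot> Zero C A B = Zero C A E"
proof -
  have Z: "Zero C A B \<in> Hom C A B" using Zero_in A Hom_Ob f by blast
  show ?thesis
    using Add_cancel_Zero[of "f \<cdot> Zero C A B" A E] Comp_Add_right[OF Z Z f] Add_Zero[OF Z] Comp_in[OF Z f]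
    by simp
qed

text \<open>Every arrow into or out of \<open>Z\<close> factors through its identity, so a single
  equation decides. Later an object is shown to vanish, or a contradiction is reached, by killing
  its identity.\<close>

lemma zero_ob_iff: "zero_ob C Z \<longleftrightarrow> Z \<in> Ob C \<and> Idt C Z = Zero C Z Z"
proof
  assume "zero_ob C Z"
  then show "Z \<in> Ob C \<and> Idt C Z = Zero C Z Z"
    unfolding zero_ob_def using Idt_in Zero_in by blast
next
  assume Z: "Z \<in> Ob C \<and> Idt C Z = Zero C Z Z"
  have "f = Zero C A Z" if "f \<in> Hom C A Z" for f A
    using Z that Idt_Comp Zero_Comp by metis
  moreover have "f = Zero C Z A" if "f \<in> Hom C Z A" for f A
    using Z that Comp_Idt Comp_Zero by metis
  ultimately show "zero_ob C Z" unfolding zero_ob_def using Zero_in Z by blast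
qed

lemma zero_ob_Hom_from: "zero_ob C Z \<Longrightarrow> f \<in> Hom C Z A \<Longrightarrow> f = Zero C Z A"
  by (metis Hom_Ob(2) Zero_in zero_ob_def)

lemma zero_ob_isomorphic:
  assumes "isomorphic C A B" "zero_ob C A"
  shows "zero_ob C B"
proof -
  obtain f g where f: "f \<in> Hom C A B" "g \<in> Hom C B A" "f \<cdot> g = Idt C B"
    using assms(1) unfolding isomorphic_def iso_arr_def by blast
  then have "f = Zero C A B" using zero_ob_Hom_from assms by blast
  then have "Idt C B = Zero C B B" using f Zero_Comp Hom_Ob by metis
  then show ?thesis using zero_ob_iff f Hom_Ob by blast
qed

lemma isomorphic_zero_obs:
  assumes "zero_ob C A" "zero_ob C B"
  shows "isomorphic C A B"
proof -
  have "Zero C A B \<in> Hom C A B" "Zero C B A \<in> Hom C B A"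
    using assms Zero_in zero_ob_iff by auto
  then show ?thesis
    unfolding isomorphic_def iso_arr_def using assms zero_ob_iff by (metis Comp_Zero)
qed

lemma additive_functor_Zero:
  assumes "additive_functor C F" "A \<in> Ob C" "B \<in> Ob C"
  shows "farr F (Zero C A B) = Zero C (fob F A) (fob F B)"
proof -
  have "farr F (Zero C A B) \<in> Hom C (fob F A) (fob F B)"
    using assms Zero_in unfolding additive_functor_def is_endofunctor_def by blast
  moreover have "Add C (farr F (Zero C A B)) (farr F (Zero C A B)) = farr F (Zero C A B)"
    using assms Zero_in Add_Zero unfolding additive_functor_def by metis
  ultimately show ?thesis using Add_cancel_Zero by blast
qed

lemma additive_functor_zero_ob:
  assumes "additive_functor C F" "zero_ob C A"
  shows "zero_ob C (fob F A)"
proof -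
  have "fob F A \<in> Ob C" "farr F (Idt C A) = Idt C (fob F A)"
    using assms zero_ob_iff unfolding additive_functor_def is_endofunctor_def by blast+
  then show ?thesis using assms zero_ob_iff additive_functor_Zero by metis
qed

text \<open>For the reflecting direction, compare with a zero object \<open>Z\<close>: the images of
  \<open>Z\<close> and \<open>A\<close> are both zero, hence isomorphic, and an auto-equivalence
  reflects isomorphism.\<close>

lemma autoequivalence_zero_ob_iff:
  assumes F: "additive_functor C F" "autoequivalence C F" and A: "A \<in> Ob C"
  shows "zero_ob C (fob F A) \<longleftrightarrow> zero_ob C A"
proof
  assume "zero_ob C (fob F A)"
  moreover obtain Z where Z: "zero_ob C Z" using ex_zero_ob by blast
  ultimately have "isomorphic C (fob F Z) (fob F A)"
    using F isomorphic_zero_obs additive_functor_zero_ob by blast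
  then have "isomorphic C Z A" using autoequivalence_isomorphicD F A Z zero_ob_iff by blast
  then show "zero_ob C A" using Z zero_ob_isomorphic by blast
qed (use F additive_functor_zero_ob in blast)

text \<open>The inverse is 1 - n, because (1 - n)(1 + n) = 1 - n n. Here \<open>n'\<close> is the
  negative of \<open>n\<close>, and the mixed products vanish because n (n + n') and (n + n') n
  do.\<close>

lemma iso_arr_unipotent:
  assumes n: "n \<in> Hom C A A" "n \<cdot> n = Zero C A A"
  shows "iso_arr C A A (Add C (Idt C A) n)"
proof -
  let ?I = "Idt C A"
  have A: "A \<in> Ob C" using n Hom_Ob by blast
  have I: "?I \<in> Hom C A A" using A Idt_in by blast
  define n' where "n' = inv\<^bsub>Hom_group C A A\<^esub> n"
  have n': "n' \<in> Hom C A A" "Add C n n' = Zero C A A" "Add C n' n = Zero C A A"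
    using neg_ex n unfolding n'_def by auto
  have "Add C (n \<cdot> n) (n \<cdot> n') = Zero C A A" "Add C (n \<cdot> n) (n' \<cdot> n) = Zero C A A"
    using Comp_Add_right[of n A A n' n A] Comp_Add_left[of n A A n A n'] n n' Zero_Comp Comp_Zero A by auto
  then have nn: "n \<cdot> n' = Zero C A A" "n' \<cdot> n = Zero C A A"
    using n n' Comp_in Zero_Add by metis+
  have "Add C ?I n' \<cdot> Add C ?I n = Add C (?I \<cdot> Add C ?I n) (n' \<cdot> Add C ?I n)"
    using Comp_Add_left n n' I Add_in by blast
  also have "n' \<cdot> Add C ?I n = n'"
    using Comp_Add_right[of ?I A A n n' A] n n' I nn Comp_Idt Add_Zero by metis
  also have "?I \<cdot> Add C ?I n = Add C ?I n" using Idt_Comp Add_in n I by blast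
  also have "Add C (Add C ?I n) n' = ?I" using Add_assoc n n' I Add_Zero by metis
  finally have 1: "Add C ?I n' \<cdot> Add C ?I n = ?I" .
  have "Add C ?I n \<cdot> Add C ?I n' = Add C (?I \<cdot> Add C ?I n') (n \<cdot> Add C ?I n')"
    using Comp_Add_left n n' I Add_in by blast
  also have "n \<cdot> Add C ?I n' = n"
    using Comp_Add_right[of ?I A A n' n A] n n' I nn Comp_Idt Add_Zero by metis
  also have "?I \<cdot> Add C ?I n' = Add C ?I n'" using Idt_Comp Add_in n' I by blast
  also have "Add C (Add C ?I n') n = ?I" using Add_assoc n n' I Add_Zero by metis
  finally show ?thesis unfolding iso_arr_def using 1 n n' I Add_in by blast
qed

end

section \<open>Triangulated categories\<close>

lemma triangle_Hom:
  assumes "triangle D X Y Z (f, g, h)"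
  shows "f \<in> Hom D X Y" "g \<in> Hom D Y Z" "h \<in> Hom D Z (sh_ob D X)" "(f, g, h) \<in> Tri D"
    "candidate D X Y Z (f, g, h)"
  using assms unfolding triangle_def candidate_def by auto

context triangulated_category
begin

lemma triangle_Ob:
  assumes "triangle D X Y Z t"
  shows "X \<in> Ob D" "Y \<in> Ob D" "Z \<in> Ob D"
  using assms Hom_Ob unfolding triangle_def candidate_def by (auto split: prod.splits)

lemma sh_Hom: "f \<in> Hom D A B \<Longrightarrow> sh_arr D f \<in> Hom D (sh_ob D A) (sh_ob D B)"
  using Shift_additive unfolding additive_functor_def is_endofunctor_def by blast

lemma sh_Ob: "A \<in> Ob D \<Longrightarrow> sh_ob D A \<in> Ob D"
  using Shift_additive unfolding additive_functor_def is_endofunctor_def by blast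

lemma sh_Idt: "A \<in> Ob D \<Longrightarrow> sh_arr D (Idt D A) = Idt D (sh_ob D A)"
  using Shift_additive unfolding additive_functor_def is_endofunctor_def by blast

lemma triangle_rotate:
  assumes "triangle D X Y Z (f, g, h)"
  shows "triangle D Y Z (sh_ob D X) (g, h, inv\<^bsub>Hom_group D (sh_ob D X) (sh_ob D Y)\<^esub> (sh_arr D f))"
  using triangle_Hom[OF assms] Tri_rotate[OF triangle_Hom(5)[OF assms]] neg_ex(1)[OF sh_Hom]
  unfolding triangle_def candidate_def by auto

lemma triangle_rotate_ex:
  "\<exists>t. triangle D X Y Z t \<Longrightarrow> \<exists>t. triangle D Y Z (sh_ob D X) t"
  using triangle_rotate by fast

text \<open>Three rotations. They put signs on the arrows, but only the objects are
  recorded.\<close>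

lemma triangle_shift_ex:
  "\<exists>t. triangle D X Y Z t \<Longrightarrow> \<exists>t. triangle D (sh_ob D X) (sh_ob D Y) (sh_ob D Z) t"
  by (intro triangle_rotate_ex)

text \<open>Rotate the axiom triangle on \<open>Idt D A\<close> backwards; the sign from the
  rotation is harmless on an arrow out of a zero object.\<close>

lemma triangle_zero_first:
  assumes A: "A \<in> Ob D" and Z: "zero_ob D Z"
  shows "triangle D Z A A (Zero D Z A, Idt D A, Zero D A (sh_ob D Z))"
proof -
  have Zob: "Z \<in> Ob D" using Z zero_ob_iff by blast
  have sZ: "zero_ob D (sh_ob D Z)" using additive_functor_zero_ob Shift_additive Z by blast
  have c: "candidate D Z A A (Zero D Z A, Idt D A, Zero D A (sh_ob D Z))"
    unfolding candidate_def using A Zob Zero_in Idt_in sh_Ob by auto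
  have "inv\<^bsub>Hom_group D (sh_ob D Z) (sh_ob D A)\<^esub> (sh_arr D (Zero D Z A)) = Zero D (sh_ob D Z) (sh_ob D A)"
    using zero_ob_Hom_from sZ neg_ex(1) sh_Hom Zero_in A Zob by metis
  then have "(Idt D A, Zero D A (sh_ob D Z),
    inv\<^bsub>Hom_group D (sh_ob D Z) (sh_ob D A)\<^esub> (sh_arr D (Zero D Z A))) \<in> Tri D"
    using Tri_id[OF A sZ] by simp
  with c Tri_rotate show ?thesis unfolding triangle_def by blast
qed

text \<open>Exactness of Hom(-, A) at the middle term: since \<open>v\<close> kills
  \<open>f\<close>, it extends to a morphism into the triangle 0 -> A -> A, whose third component is
  the factorisation. Nothing makes that component unique.\<close>

lemma triangle_factor:
  assumes t: "triangle D X Y Z (f, g, h)" and v: "v \<in> Hom D Y A" and vf: "v \<cdot> f = Zero D X A"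
  shows "\<exists>w \<in> Hom D Z A. w \<cdot> g = v"
proof -
  obtain W where W: "zero_ob D W" using ex_zero_ob by blast
  have ob: "W \<in> Ob D" "A \<in> Ob D" "X \<in> Ob D" using W zero_ob_iff Hom_Ob v triangle_Ob t by blast+
  have "v \<cdot> f = Zero D W A \<cdot> Zero D X W" using vf ob Zero_Comp Zero_in by metis
  from Tri_morphism[OF t triangle_zero_first[OF ob(2) W] Zero_in[OF ob(3,1)] v this]
  show ?thesis using v Idt_Comp by metis
qed

text \<open>An arrow out of the middle term dies on \<open>X\<close>, hence comes from
  \<open>Z\<close>, where there are none but zero. This is the induction step for vanishing along a
  filtration.\<close>

lemma triangle_Hom_vanish:
  assumes t: "triangle D X Y Z t"
    and X: "Hom D X A = {Zero D X A}" and Z: "Hom D Z A = {Zero D Z A}" and A: "A \<in> Ob D"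
  shows "Hom D Y A = {Zero D Y A}"
proof -
  obtain f g h where fgh: "triangle D X Y Z (f, g, h)" using t by (cases t) auto
  have "v = Zero D Y A" if v: "v \<in> Hom D Y A" for v
  proof -
    have "v \<cdot> f = Zero D X A" using Comp_in[OF triangle_Hom(1)[OF fgh] v] X by blast
    then obtain w where "w \<in> Hom D Z A" "w \<cdot> g = v" using triangle_factor[OF fgh v] by blast
    then show ?thesis using Z Zero_Comp[OF triangle_Hom(2)[OF fgh] A] by auto
  qed
  then show ?thesis using Zero_in triangle_Ob t A by blast
qed

text \<open>Replaces the five lemma: \<open>z - 1\<close> annihilates \<open>g\<close>, so it factors through \<open>h\<close>, and \<open>h\<close>
  annihilates it on the other side; hence \<open>z\<close> is unipotent.\<close>

lemma triangle_endo_iso: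
  assumes t: "triangle D X Y Z (f, g, h)" and z: "z \<in> Hom D Z Z" "z \<cdot> g = g" "h \<cdot> z = h"
  shows "iso_arr D Z Z z"
proof -
  have ob: "X \<in> Ob D" "Y \<in> Ob D" "Z \<in> Ob D" using triangle_Ob t by blast+
  note h = triangle_Hom[OF t]
  obtain n where n: "n \<in> Hom D Z Z" "z = Add D (Idt D Z) n"
    using Add_diff_ex[OF z(1) Idt_in[OF ob(3)]] by blast
  have "Add D g (n \<cdot> g) = g"
    using Comp_Add_left[OF h(2) Idt_in[OF ob(3)] n(1)] z n Idt_Comp h by metis
  then have ng: "n \<cdot> g = Zero D Y Z" using Add_cancel_Zero h n Comp_in by blast
  have "Add D h (h \<cdot> n) = h"
    using Comp_Add_right[OF Idt_in[OF ob(3)] n(1) h(3)] z n Comp_Idt h by metis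
  then have hn: "h \<cdot> n = Zero D Z (sh_ob D X)" using Add_cancel_Zero h n Comp_in by blast
  obtain y where y: "y \<in> Hom D (sh_ob D X) Z" "y \<cdot> h = n"
    using triangle_factor[OF triangle_rotate[OF t] n(1) ng] by blast
  have "n \<cdot> n = y \<cdot> (h \<cdot> n)" using y Comp_assoc n h by metis
  then have "n \<cdot> n = Zero D Z Z" using hn Comp_Zero y ob by metis
  then show ?thesis using iso_arr_unipotent n by blast
qed

text \<open>Fill-ins are not canonical, so \<open>w' \<cdot> w\<close> need not be the identity; but
  it fixes \<open>g\<close> and \<open>h\<close>, which is what \<open>triangle_endo_iso\<close>
  asks for.\<close>

lemma triangle_round_trip:
  assumes t: "triangle D X Y Z (f, g, h)" and t': "triangle D X' Y' Z' (f', g', h')"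
    and u: "u \<in> Hom D X X'" "u' \<in> Hom D X' X" "u' \<cdot> u = Idt D X"
    and v: "v \<in> Hom D Y Y'" "v' \<in> Hom D Y' Y" "v' \<cdot> v = Idt D Y"
    and w: "w \<in> Hom D Z Z'" "w \<cdot> g = g' \<cdot> v" "sh_arr D u \<cdot> h = h' \<cdot> w"
    and w': "w' \<in> Hom D Z' Z" "w' \<cdot> g' = g \<cdot> v'" "sh_arr D u' \<cdot> h' = h \<cdot> w'"
  shows "iso_arr D Z Z (w' \<cdot> w)"
proof -
  note h = triangle_Hom[OF t] and h' = triangle_Hom[OF t']
  note su = sh_Hom[OF u(1)] sh_Hom[OF u(2)]
  have sh: "sh_arr D u' \<cdot> sh_arr D u = Idt D (sh_ob D X)"
    using Shift_additive u sh_Idt triangle_Ob[OF t]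
    unfolding additive_functor_def is_endofunctor_def by metis
  have "(w' \<cdot> w) \<cdot> g = w' \<cdot> (g' \<cdot> v)" using w Comp_assoc[OF h(2) w(1) w'(1)] by simp
  also have "\<dots> = (g \<cdot> v') \<cdot> v" using w' Comp_assoc[OF v(1) h'(2) w'(1)] by simp
  also have "\<dots> = g" using v Comp_assoc[OF v(1,2) h(2)] Comp_Idt[OF h(2)] by simp
  finally have 1: "(w' \<cdot> w) \<cdot> g = g" .
  have "h \<cdot> (w' \<cdot> w) = (sh_arr D u' \<cdot> h') \<cdot> w" using w' Comp_assoc[OF w(1) w'(1) h(3)] by simp
  also have "\<dots> = sh_arr D u' \<cdot> (sh_arr D u \<cdot> h)" using w Comp_assoc[OF w(1) h'(3) su(2)] by simp
  also have "\<dots> = h" using sh Comp_assoc[OF h(3) su] Idt_Comp[OF h(3)] by simp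
  finally have 2: "h \<cdot> (w' \<cdot> w) = h" .
  show ?thesis using triangle_endo_iso[OF t Comp_in[OF w(1) w'(1)] 1 2] .
qed

text \<open>Uniqueness of cones, from fill-ins in both directions whose two composites are
  automorphisms.\<close>

lemma triangle_third_isomorphic:
  assumes t: "triangle D X Y Z (f, g, h)" and t': "triangle D X' Y' Z' (f', g', h')"
    and u: "iso_arr D X X' u" and v: "iso_arr D Y Y' v" and c: "v \<cdot> f = f' \<cdot> u"
  shows "isomorphic D Z Z'"
proof -
  obtain u' where u': "u \<in> Hom D X X'" "u' \<in> Hom D X' X" "u' \<cdot> u = Idt D X" "u \<cdot> u' = Idt D X'"
    using u by (rule iso_arrE)
  obtain v' where v': "v \<in> Hom D Y Y'" "v' \<in> Hom D Y' Y" "v' \<cdot> v = Idt D Y" "v \<cdot> v' = Idt D Y'"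
    using v by (rule iso_arrE)
  note h = triangle_Hom[OF t] and h' = triangle_Hom[OF t']
  note ob = triangle_Ob[OF t] and ob' = triangle_Ob[OF t']
  \<comment> \<open>The reversed square, conjugated from \<open>c\<close>, is the input for the
    fill-in going back.\<close>
  have "v' \<cdot> f' = v' \<cdot> (f' \<cdot> (u \<cdot> u'))" using u' h' Comp_Idt by metis
  also have "\<dots> = v' \<cdot> ((f' \<cdot> u) \<cdot> u')" using u' h' Comp_assoc by metis
  also have "\<dots> = v' \<cdot> (v \<cdot> (f \<cdot> u'))" using c u' v' h Comp_assoc by metis
  also have "\<dots> = (v' \<cdot> v) \<cdot> (f \<cdot> u')"
    using Comp_assoc[OF Comp_in[OF u'(2) h(1)] v'(1,2)] .
  also have "\<dots> = f \<cdot> u'" using v' Idt_Comp[OF Comp_in[OF u'(2) h(1)]] by simp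
  finally have c': "v' \<cdot> f' = f \<cdot> u'" .
  obtain w where w: "w \<in> Hom D Z Z'" "w \<cdot> g = g' \<cdot> v" "sh_arr D u \<cdot> h = h' \<cdot> w"
    using Tri_morphism[OF t t' u'(1) v'(1) c] by blast
  obtain w' where w': "w' \<in> Hom D Z' Z" "w' \<cdot> g' = g \<cdot> v'" "sh_arr D u' \<cdot> h' = h \<cdot> w'"
    using Tri_morphism[OF t' t u'(2) v'(2) c'] by blast
  obtain p where p: "p \<in> Hom D Z Z" "p \<cdot> (w' \<cdot> w) = Idt D Z"
    using triangle_round_trip[OF t t' u'(1-3) v'(1-3) w w'] by (blast elim: iso_arrE)
  obtain q where q: "q \<in> Hom D Z' Z'" "(w \<cdot> w') \<cdot> q = Idt D Z'"
    using triangle_round_trip[OF t' t u'(2,1,4) v'(2,1,4) w' w] by (blast elim: iso_arrE)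
  \<comment> \<open>The inverses \<open>p\<close> and \<open>q\<close> of the round trips correct
    \<open>w'\<close> to a left and a right inverse of \<open>w\<close>, which then agree.\<close>
  have "(p \<cdot> w') \<cdot> w = Idt D Z" "w \<cdot> (w' \<cdot> q) = Idt D Z'"
    using p q Comp_assoc[OF w(1) w'(1) p(1)] Comp_assoc[OF q(1) w'(1) w(1)] by simp_all
  then have "iso_arr D Z Z' w"
    using iso_arrI_left_right[OF w(1)] Comp_in p q w' by blast
  then show ?thesis unfolding isomorphic_def by blast
qed

lemma triangle_iso_middle:
  assumes t: "triangle D X Y Z (f, g, h)" and v: "iso_arr D Y Y' v"
  shows "\<exists>t. triangle D X Y' Z t"
proof -
  obtain v' where v': "v \<in> Hom D Y Y'" "v' \<in> Hom D Y' Y" "v' \<cdot> v = Idt D Y" "v \<cdot> v' = Idt D Y'"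
    using v by (rule iso_arrE)
  note h = triangle_Hom[OF t] and ob = triangle_Ob[OF t]
  have c: "candidate D X Y' Z (v \<cdot> f, g \<cdot> v', h)"
    unfolding candidate_def using h v' Comp_in by auto
  have "v \<cdot> f = (v \<cdot> f) \<cdot> Idt D X" using Comp_Idt Comp_in v' h by metis
  moreover have "Idt D Z \<cdot> g = (g \<cdot> v') \<cdot> v" using Idt_Comp Comp_Idt Comp_assoc h v' by metis
  moreover have "sh_arr D (Idt D X) \<cdot> h = h \<cdot> Idt D Z" using sh_Idt ob h Idt_Comp Comp_Idt by metis
  ultimately show ?thesis
    using Tri_iso[OF t c iso_arr_Idt[OF ob(1)] v iso_arr_Idt[OF ob(3)]] c unfolding triangle_def by blast
qed

lemma triangle_of_isomorphic:
  assumes "isomorphic D A B" "zero_ob D Z"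
  shows "\<exists>t. triangle D A B Z t"
proof -
  obtain v where v: "iso_arr D A B v" using assms unfolding isomorphic_def by blast
  have ob: "A \<in> Ob D" "Z \<in> Ob D" using v iso_arr_Ob assms zero_ob_iff by auto
  have "triangle D A A Z (Idt D A, Zero D A Z, Zero D Z (sh_ob D A))"
    using Tri_id ob assms Idt_in Zero_in sh_Ob unfolding triangle_def candidate_def by auto
  then show ?thesis using v triangle_iso_middle by blast
qed

end

section \<open>The Grothendieck group\<close>

context triangulated_category
begin

lemma K0_relations_subgroup: "subgroup (K0_relations D) (free_Abelian_group (Ob D))"
  unfolding K0_relations_def
proof (rule group.generate_is_subgroup)
  show "{frag_of Y - frag_of X - frag_of Z | X Y Z. \<exists>t. triangle D X Y Z t}
    \<subseteq> carrier (free_Abelian_group (Ob D))"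
  proof clarsimp
    fix X Y Z f g h W
    assume t: "triangle D X Y Z (f, g, h)" and "W \<in> Poly_Mapping.keys (frag_of Y - frag_of X - frag_of Z)"
    then have "W \<in> {X, Y, Z}"
      using keys_diff[of "frag_of Y - frag_of X" "frag_of Z"] keys_diff[of "frag_of Y" "frag_of X"] by auto
    then show "W \<in> Ob D" using triangle_Ob[OF t] by auto
  qed
qed simp

lemma K0_relations_normal: "normal (K0_relations D) (free_Abelian_group (Ob D))"
  using comm_group.normal_iff_subgroup[OF abelian_free_Abelian_group] K0_relations_subgroup by blast

lemma group_K0: "group (K0 D)"
  unfolding K0_def by (rule normal.factorgroup_is_group[OF K0_relations_normal])

lemma K0_class_in: "E \<in> Ob D \<Longrightarrow> K0_class D E \<in> carrier (K0 D)"
  unfolding K0_class_def K0_def carrier_FactGroup by simp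

text \<open>The triangle A -> B -> 0 gives [B] = [A] + [0]. The triangle 0 -> 0 -> 0 gives the
  relation -[0], whose inverse shows [0] = 0.\<close>

lemma K0_class_isomorphic:
  assumes "isomorphic D A B"
  shows "K0_class D A = K0_class D B"
proof -
  let ?G = "free_Abelian_group (Ob D)"
  obtain Z where Z: "zero_ob D Z" using ex_zero_ob by blast
  note ob = isomorphic_Ob[OF assms]
  have zz: "Z \<in> Ob D" using Z zero_ob_iff by blast
  have gen: "frag_of Y - frag_of X - frag_of W \<in> K0_relations D" if "\<exists>t. triangle D X Y W t" for X Y W
    unfolding K0_relations_def using that by (blast intro: generate.incl)
  have 1: "frag_of B - frag_of A - frag_of Z \<in> K0_relations D"
    using gen triangle_of_isomorphic[OF assms Z] by blast
  have "frag_of Z - frag_of Z - frag_of Z \<in> K0_relations D"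
    using gen triangle_of_isomorphic[OF isomorphic_refl[OF zz] Z] by blast
  then have "inv\<^bsub>?G\<^esub> (frag_of Z - frag_of Z - frag_of Z) \<in> K0_relations D"
    using K0_relations_subgroup by (rule subgroup.m_inv_closed[rotated])
  then have 2: "frag_of Z \<in> K0_relations D" using zz by simp
  have "frag_of B - frag_of A \<in> K0_relations D"
    using subgroup.m_closed[OF K0_relations_subgroup 1 2] by simp
  moreover have "frag_of B = (frag_of B - frag_of A) \<otimes>\<^bsub>?G\<^esub> frag_of A" by simp
  ultimately have "frag_of B \<in> K0_relations D #>\<^bsub>?G\<^esub> frag_of A"
    unfolding r_coset_def by blast
  then show ?thesis
    unfolding K0_class_def
    using group.repr_independence[OF group_free_Abelian_group _ _ K0_relations_subgroup, of "frag_of B" "frag_of A"] ob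
    by simp
qed

text \<open>Classes of objects generate: pull back to the free abelian group and induct there. This
  pins down the map on \<open>K0 D\<close> induced by a functor, and with it
  \<open>lattice_action\<close>.\<close>

lemma K0_hom_eqI:
  assumes k: "k \<in> hom (K0 D) H" "k' \<in> hom (K0 D) H" and H: "group H"
    and eq: "\<And>E. E \<in> Ob D \<Longrightarrow> k (K0_class D E) = k' (K0_class D E)" and x: "x \<in> carrier (K0 D)"
  shows "k x = k' x"
proof -
  let ?G = "free_Abelian_group (Ob D)"
  define p where "p c = K0_relations D #>\<^bsub>?G\<^esub> c" for c
  have p: "p \<in> hom ?G (K0 D)"
    unfolding p_def[abs_def] K0_def by (rule normal.r_coset_hom_Mod[OF K0_relations_normal])
  have kp: "group_hom ?G H (k \<circ> p)" "group_hom ?G H (k' \<circ> p)"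
    using hom_compose[OF p k(1)] hom_compose[OF p k(2)] H
    by (auto intro!: group_hom.intro simp: group_hom_axioms_def)
  obtain c where c: "c \<in> carrier ?G" "x = p c"
    using x unfolding K0_def carrier_FactGroup p_def by blast
  have diff: "(j \<circ> p) (a - b) = (j \<circ> p) a \<otimes>\<^bsub>H\<^esub> inv\<^bsub>H\<^esub> (j \<circ> p) b"
    if j: "group_hom ?G H (j \<circ> p)" and ab: "Poly_Mapping.keys a \<subseteq> Ob D" "Poly_Mapping.keys b \<subseteq> Ob D"
    for j a b
    using group_hom.hom_mult[OF j, of a "-b"] group_hom.hom_inv[OF j, of b] ab by simp
  have "(k \<circ> p) c = (k' \<circ> p) c"
  proof (rule free_Abelian_group_induct[of c "Ob D"])
    show "Poly_Mapping.keys c \<subseteq> Ob D" using c by simp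
    show "(k \<circ> p) 0 = (k' \<circ> p) 0"
      using group_hom.hom_one[OF kp(1)] group_hom.hom_one[OF kp(2)] by simp
    show "(k \<circ> p) (frag_of a) = (k' \<circ> p) (frag_of a)" if "a \<in> Ob D" for a
      using eq[OF that] unfolding p_def K0_class_def by simp
  qed (use diff[OF kp(1)] diff[OF kp(2)] in auto)
  then show ?thesis using c by simp
qed

end

section \<open>Slicings and Harder--Narasimhan filtrations\<close>

text \<open>Collects what the uniqueness of Harder--Narasimhan filtrations rests on, so that it
  applies to \<open>c_act \<Lambda> \<sigma> w\<close> without first placing this in
  \<open>Stab D \<nu> \<Lambda> N\<close>.\<close>

definition slicing :: "('o, 'm, 'x) tri_cat_scheme \<Rightarrow> (real \<Rightarrow> 'o set) \<Rightarrow> bool" where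
  "slicing D P \<longleftrightarrow> (\<forall>\<phi>. additive_subcat D (P \<phi>)) \<and>
    (\<forall>\<phi>. P (\<phi> + 1) = iso_closure D (sh_ob D ` P \<phi>)) \<and>
    (\<forall>\<phi> \<psi>. \<forall>A \<in> P \<phi>. \<forall>B \<in> P \<psi>. \<phi> > \<psi> \<longrightarrow> Hom D A B = {Zero D A B})"

lemma HN_filtration_Nil: "HN_filtration D P E [] \<longleftrightarrow> zero_ob D E"
  unfolding HN_filtration_def by auto

text \<open>Turns the indexed chain of triangles into a recursion on the last factor; later
  arguments about filtrations induct along it from the right end of the list.\<close>

lemma HN_filtration_snoc:
  "HN_filtration D P E (xs @ [(A, \<phi>)]) \<longleftrightarrow>
    (\<exists>X t. HN_filtration D P X xs \<and> triangle D X E A t) \<and> A \<in> P \<phi> \<and> \<not> zero_ob D A \<and>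
    (\<forall>x \<in> set xs. \<phi> < snd x)" (is "?L \<longleftrightarrow> ?R")
proof
  assume ?L
  then obtain Es where Es: "zero_ob D (Es 0)" "Es (Suc (length xs)) = E"
      "\<And>i. i < Suc (length xs) \<Longrightarrow> \<exists>t. triangle D (Es i) (Es (Suc i)) (fst ((xs @ [(A, \<phi>)]) ! i)) t"
    and P: "\<forall>(A, \<phi>) \<in> set (xs @ [(A, \<phi>)]). A \<in> P \<phi> \<and> \<not> zero_ob D A"
    and s: "sorted_wrt (>) (map snd (xs @ [(A, \<phi>)]))"
    unfolding HN_filtration_def by auto
  have tri: "\<exists>t. triangle D (Es i) (Es (Suc i)) (fst (xs ! i)) t" if "i < length xs" for i
    using Es(3)[of i] that by (simp add: nth_append)
  have "HN_filtration D P (Es (length xs)) xs"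
    unfolding HN_filtration_def using Es(1) tri P s by (auto simp: sorted_wrt_append intro!: exI[of _ Es])
  moreover have "\<exists>t. triangle D (Es (length xs)) E A t"
    using Es(2) Es(3)[of "length xs"] by simp
  ultimately show ?R using P s by (auto simp: sorted_wrt_append)
next
  assume R: ?R
  then obtain X t where X: "HN_filtration D P X xs" "triangle D X E A t" by blast
  then obtain Es where Es: "zero_ob D (Es 0)" "Es (length xs) = X"
      "\<forall>i < length xs. \<exists>t. triangle D (Es i) (Es (Suc i)) (fst (xs ! i)) t"
    and P: "\<forall>(A, \<phi>) \<in> set xs. A \<in> P \<phi> \<and> \<not> zero_ob D A"
    and s: "sorted_wrt (>) (map snd xs)"
    unfolding HN_filtration_def by blast
  let ?Es = "Es(Suc (length xs) := E)"
  have "\<exists>t. triangle D (?Es i) (?Es (Suc i)) (fst ((xs @ [(A, \<phi>)]) ! i)) t"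
    if "i < length (xs @ [(A, \<phi>)])" for i
  proof (cases "i = length xs")
    case True
    have "\<exists>t. triangle D X E A t" using X(2) by (rule exI)
    then show ?thesis using True Es(2) by simp
  next
    case False
    then show ?thesis using that Es(3) by (simp add: nth_append)
  qed
  then show ?L
    unfolding HN_filtration_def using Es(1) P s R
    by (auto simp: sorted_wrt_append intro!: exI[of _ ?Es])
qed

lemma HN_filtration_shift:
  "HN_filtration D (\<lambda>\<phi>. P (\<phi> + r)) E xs \<longleftrightarrow> HN_filtration D P E (map (\<lambda>(A, \<phi>). (A, \<phi> + r)) xs)"
proof (induction xs arbitrary: E rule: rev_induct)
  case Nil
  then show ?case by (simp add: HN_filtration_Nil)
next
  case (snoc x xs)
  obtain A \<phi> where "x = (A, \<phi>)" by (cases x)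
  then show ?case using snoc by (force simp: HN_filtration_snoc)
qed

lemma slicing_shift: "slicing D P \<Longrightarrow> slicing D (\<lambda>\<phi>. P (\<phi> + r))"
  unfolding slicing_def by (metis add.assoc add.commute add_less_cancel_right)

context triangulated_category
begin

text \<open>Only the last triangle mentions \<open>E\<close>, and its middle term can be exchanged
  along an isomorphism.\<close>

lemma HN_filtration_isomorphic:
  assumes E: "HN_filtration D P E xs" and iso: "isomorphic D E E'"
  shows "HN_filtration D P E' xs"
proof (cases xs rule: rev_cases)
  case Nil
  then show ?thesis using E zero_ob_isomorphic[OF iso] by (simp add: HN_filtration_Nil)
next
  case (snoc ys x)
  obtain A \<phi> where x: "x = (A, \<phi>)" by (cases x)
  have "\<exists>t. triangle D X E' A t" if "triangle D X E A t" for X t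
    using that iso triangle_iso_middle unfolding isomorphic_def by (cases t) blast
  then show ?thesis using E unfolding snoc x HN_filtration_snoc by blast
qed

section \<open>Vanishing of Hom and uniqueness of Harder--Narasimhan filtrations\<close>

context
  fixes P :: "real \<Rightarrow> 'o set"
  assumes P: "slicing D P"
begin

lemma slicing_Ob: "A \<in> P \<phi> \<Longrightarrow> A \<in> Ob D"
  using P unfolding slicing_def additive_subcat_def by blast

lemma slicing_sh: "A \<in> P \<phi> \<Longrightarrow> sh_ob D A \<in> P (\<phi> + 1)"
proof -
  assume A: "A \<in> P \<phi>"
  then have "sh_ob D A \<in> iso_closure D (sh_ob D ` P \<phi>)"
    using isomorphic_refl[OF sh_Ob[OF slicing_Ob[OF A]]] sh_Ob[OF slicing_Ob[OF A]]
    unfolding iso_closure_def by blast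
  then show ?thesis using P unfolding slicing_def by blast
qed

lemma slicing_vanish: "A \<in> P \<phi> \<Longrightarrow> B \<in> P \<psi> \<Longrightarrow> \<psi> < \<phi> \<Longrightarrow> Hom D A B = {Zero D A B}"
  using P unfolding slicing_def by blast

text \<open>Shifting raises phases by one, so the same gap kills Hom from \<open>sh_ob D X\<close>.
  Both halves are used: arrows out of \<open>X\<close> obstruct a factorisation through the last
  factor, arrows out of the shift measure its ambiguity.\<close>

lemma HN_filtration_vanish:
  assumes "HN_filtration D P X xs" "\<And>x. x \<in> set xs \<Longrightarrow> \<psi> < snd x" and B: "B \<in> P \<psi>"
  shows "Hom D X B = {Zero D X B} \<and> Hom D (sh_ob D X) B = {Zero D (sh_ob D X) B}"
  using assms(1,2)
proof (induction xs arbitrary: X rule: rev_induct)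
  case Nil
  then have X: "zero_ob D X" by (simp add: HN_filtration_Nil)
  then have "zero_ob D (sh_ob D X)" using additive_functor_zero_ob Shift_additive by blast
  then show ?case
    using X zero_ob_Hom_from Zero_in[OF _ slicing_Ob[OF B]] zero_ob_iff by blast
next
  case (snoc x xs)
  obtain A \<phi> where x: "x = (A, \<phi>)" by (cases x)
  obtain Y t where Y: "HN_filtration D P Y xs" "triangle D Y X A t" and A: "A \<in> P \<phi>"
    using snoc.prems(1) unfolding x HN_filtration_snoc by blast
  have lt: "\<psi> < \<phi>" using snoc.prems(2) x by force
  have IH: "Hom D Y B = {Zero D Y B}" "Hom D (sh_ob D Y) B = {Zero D (sh_ob D Y) B}"
    using snoc.IH[OF Y(1)] snoc.prems(2) by auto
  obtain t' where t': "triangle D (sh_ob D Y) (sh_ob D X) (sh_ob D A) t'"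
    using triangle_shift_ex Y(2) by blast
  have "Hom D A B = {Zero D A B}" "Hom D (sh_ob D A) B = {Zero D (sh_ob D A) B}"
    using slicing_vanish[OF A B lt] slicing_vanish[OF slicing_sh[OF A] B] lt by auto
  then show ?case
    using triangle_Hom_vanish[OF Y(2) IH(1)] triangle_Hom_vanish[OF t' IH(2)] slicing_Ob[OF B] by blast
qed

text \<open>If \<open>g\<close> were zero, the identity of \<open>A\<close> would kill it and hence
  factor through the shift of \<open>X\<close>, which has no non-zero arrows to
  \<open>A\<close>.\<close>

lemma HN_filtration_snoc_arrow_nonzero:
  assumes X: "HN_filtration D P X xs" "\<And>x. x \<in> set xs \<Longrightarrow> \<phi> < snd x"
    and A: "A \<in> P \<phi>" "\<not> zero_ob D A" and t: "triangle D X E A (f, g, h)"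
  shows "g \<noteq> Zero D E A"
proof
  assume g: "g = Zero D E A"
  note ob = triangle_Ob[OF t]
  have "Idt D A \<cdot> g = Zero D E A" using g Idt_Comp triangle_Hom[OF t] by simp
  then obtain y where y: "y \<in> Hom D (sh_ob D X) A" "y \<cdot> h = Idt D A"
    using triangle_factor[OF triangle_rotate[OF t] Idt_in[OF ob(3)]] by blast
  then have "y = Zero D (sh_ob D X) A" using HN_filtration_vanish[OF X A(1)] by blast
  then have "Idt D A = Zero D A A" using y Zero_Comp[OF triangle_Hom(3)[OF t] ob(3)] by simp
  then show False using A ob zero_ob_iff by blast
qed

lemma HN_filtration_snoc_nonzero:
  assumes "HN_filtration D P E (xs @ [x])"
  shows "\<not> zero_ob D E"
proof
  assume E: "zero_ob D E"
  obtain A \<phi> where x: "x = (A, \<phi>)" by (cases x)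
  obtain X f g h where X: "HN_filtration D P X xs" "triangle D X E A (f, g, h)"
    and A: "A \<in> P \<phi>" "\<not> zero_ob D A" "\<forall>x \<in> set xs. \<phi> < snd x"
    using assms unfolding x HN_filtration_snoc by (metis prod_cases3)
  have "g = Zero D E A" using E zero_ob_Hom_from triangle_Hom(2)[OF X(2)] by blast
  then show False using HN_filtration_snoc_arrow_nonzero[OF X(1) _ A(1,2) X(2)] A(3) by blast
qed

text \<open>The phases of \<open>Y\<close> exceed \<psi> and so \<phi>, hence \<open>g\<close> kills
  \<open>f'\<close> and factors through \<open>B\<close>; a strict inequality would make the
  factorisation zero, against \<open>g\<close> being non-zero. Used with the two filtrations in
  either order, so that one of the two inequalities always applies.\<close>

lemma HN_filtration_last_factor:
  assumes X: "HN_filtration D P X xs" "\<And>x. x \<in> set xs \<Longrightarrow> \<phi> < snd x"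
    and A: "A \<in> P \<phi>" "\<not> zero_ob D A" and t: "triangle D X E A (f, g, h)"
    and Y: "HN_filtration D P Y ys" "\<And>y. y \<in> set ys \<Longrightarrow> \<psi> < snd y"
    and B: "B \<in> P \<psi>" and t': "triangle D Y E B (f', g', h')" and le: "\<phi> \<le> \<psi>"
  shows "\<phi> = \<psi> \<and> (\<exists>p \<in> Hom D B A. p \<cdot> g' = g)"
proof -
  have "Hom D Y A = {Zero D Y A}"
    using HN_filtration_vanish[OF Y(1) _ A(1)] Y(2) le by fastforce
  then have "g \<cdot> f' = Zero D Y A"
    using Comp_in[OF triangle_Hom(1)[OF t'] triangle_Hom(2)[OF t]] by blast
  then obtain p where p: "p \<in> Hom D B A" "p \<cdot> g' = g"
    using triangle_factor[OF t' triangle_Hom(2)[OF t]] by blast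
  have "p = Zero D B A" if "\<phi> < \<psi>" using slicing_vanish[OF B A(1) that] p by blast
  then have "g = Zero D E A" if "\<phi> < \<psi>"
    using that p Zero_Comp[OF triangle_Hom(2)[OF t'] slicing_Ob[OF A(1)]] by simp
  then show ?thesis
    using p le HN_filtration_snoc_arrow_nonzero[OF X A t] by fastforce
qed

text \<open>The difference of \<open>r\<close> and the identity kills \<open>g\<close>, so it
  factors through the shift of \<open>X\<close> and vanishes. This supplies the uniqueness that
  \<open>triangle_factor\<close> lacks.\<close>

lemma HN_filtration_last_endo:
  assumes X: "HN_filtration D P X xs" "\<And>x. x \<in> set xs \<Longrightarrow> \<phi> < snd x"
    and A: "A \<in> P \<phi>" and t: "triangle D X E A (f, g, h)"
    and r: "r \<in> Hom D A A" "r \<cdot> g = g"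
  shows "r = Idt D A"
proof -
  note ob = triangle_Ob[OF t] and h = triangle_Hom[OF t]
  obtain d where d: "d \<in> Hom D A A" "r = Add D (Idt D A) d"
    using Add_diff_ex[OF r(1) Idt_in[OF ob(3)]] by blast
  have "Add D g (d \<cdot> g) = g"
    using Comp_Add_left[OF h(2) Idt_in[OF ob(3)] d(1)] d r Idt_Comp[OF h(2)] by simp
  then have "d \<cdot> g = Zero D E A" using Add_cancel_Zero[OF h(2) Comp_in[OF h(2) d(1)]] by blast
  then obtain y where y: "y \<in> Hom D (sh_ob D X) A" "y \<cdot> h = d"
    using triangle_factor[OF triangle_rotate[OF t] d(1)] by blast
  then have "y = Zero D (sh_ob D X) A" using HN_filtration_vanish[OF X A(1)] by blast
  then have "d = Zero D A A" using y Zero_Comp[OF h(3) ob(3)] by simp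
  then show ?thesis using d Add_Zero[OF Idt_in[OF ob(3)]] by simp
qed

text \<open>Isomorphic rather than equal objects are allowed because the induction descends to the
  previous steps \<open>X\<close> and \<open>Y\<close>, known only to be isomorphic.\<close>

theorem HN_filtration_unique:
  assumes "HN_filtration D P E xs" "HN_filtration D P E' ys" "isomorphic D E E'"
  shows "list_all2 (\<lambda>(A, \<phi>) (B, \<psi>). isomorphic D A B \<and> \<phi> = \<psi>) xs ys"
  using assms
proof (induction xs arbitrary: ys E E' rule: rev_induct)
  case Nil
  then have "zero_ob D E'" using zero_ob_isomorphic by (simp add: HN_filtration_Nil)
  then show ?case
    using Nil.prems(2) HN_filtration_snoc_nonzero by (cases ys rule: rev_cases) auto
next
  case (snoc x xs)
  obtain A \<phi> where x: "x = (A, \<phi>)" by (cases x)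
  have E: "HN_filtration D P E ys"
    using HN_filtration_isomorphic snoc.prems(2,3) isomorphic_sym by blast
  have "\<not> zero_ob D E" using HN_filtration_snoc_nonzero snoc.prems(1) by blast
  then obtain zs B \<psi> where ys: "ys = zs @ [(B, \<psi>)]"
    using E by (cases ys rule: rev_cases) (auto simp: HN_filtration_Nil)
  obtain X f g h where X: "HN_filtration D P X xs" "triangle D X E A (f, g, h)"
    and A: "A \<in> P \<phi>" "\<not> zero_ob D A" "\<And>x. x \<in> set xs \<Longrightarrow> \<phi> < snd x"
    using snoc.prems(1) unfolding x HN_filtration_snoc by (metis prod_cases3)
  obtain Y f' g' h' where Y: "HN_filtration D P Y zs" "triangle D Y E B (f', g', h')"
    and B: "B \<in> P \<psi>" "\<not> zero_ob D B" "\<And>x. x \<in> set zs \<Longrightarrow> \<psi> < snd x"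
    using E unfolding ys HN_filtration_snoc by (metis prod_cases3)
  note AB = HN_filtration_last_factor[OF X(1) A(3,1,2) X(2) Y(1) B(3,1) Y(2)]
    and BA = HN_filtration_last_factor[OF Y(1) B(3,1,2) Y(2) X(1) A(3,1) X(2)]
  have eq: "\<phi> = \<psi>" using AB BA by fastforce
  obtain p where p: "p \<in> Hom D B A" "p \<cdot> g' = g" using AB eq by blast
  obtain q where q: "q \<in> Hom D A B" "q \<cdot> g = g'" using BA eq by blast
  have "(p \<cdot> q) \<cdot> g = g"
    using Comp_assoc[OF triangle_Hom(2)[OF X(2)] q(1) p(1)] p q by simp
  then have pq: "p \<cdot> q = Idt D A"
    using HN_filtration_last_endo[OF X(1) A(3,1) X(2)] Comp_in p q by blast
  have "(q \<cdot> p) \<cdot> g' = g'"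
    using Comp_assoc[OF triangle_Hom(2)[OF Y(2)] p(1) q(1)] p q by simp
  then have qp: "q \<cdot> p = Idt D B"
    using HN_filtration_last_endo[OF Y(1) B(3,1) Y(2)] Comp_in p q by blast
  have iso: "iso_arr D A B q" unfolding iso_arr_def using p q pq qp by blast
  have Eob: "E \<in> Ob D" using triangle_Ob X(2) by blast
  \<comment> \<open>After rotation the shifts of \<open>X\<close> and \<open>Y\<close> are the cones
    of \<open>g\<close> and \<open>g'\<close>, and the identity of \<open>E\<close> together with
    \<open>q\<close> identifies these two arrows.\<close>
  have "q \<cdot> g = g' \<cdot> Idt D E" using q Comp_Idt[OF triangle_Hom(2)[OF Y(2)]] by simp
  then have "isomorphic D (sh_ob D X) (sh_ob D Y)"
    using triangle_third_isomorphic[OF triangle_rotate[OF X(2)] triangle_rotate[OF Y(2)]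
        iso_arr_Idt[OF Eob] iso] by blast
  then have "isomorphic D X Y"
    using autoequivalence_isomorphicD[OF Shift_equiv] triangle_Ob X(2) Y(2) by blast
  then have "list_all2 (\<lambda>(A, \<phi>) (B, \<psi>). isomorphic D A B \<and> \<phi> = \<psi>) xs zs"
    using snoc.IH X(1) Y(1) by blast
  moreover have "isomorphic D A B" using iso unfolding isomorphic_def by blast
  ultimately show ?case using eq by (simp add: x ys list_all2_appendI)
qed

end

end

section \<open>Stability conditions and the action of \<open>\<complex>\<close>\<close>

lemma sum_list_list_all2: "list_all2 (\<lambda>x y. f x = g y) xs ys \<Longrightarrow> sum_list (map f xs) = sum_list (map g ys)"
  by (induction rule: list_all2_induct) auto

locale stability_setting = triangulated_category D
  for D :: "('o, 'm) tri_cat" (structure) +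
  fixes \<nu> :: "('o \<Rightarrow>\<^sub>0 int) set \<Rightarrow> 'v::real_vector"
    and \<Lambda> :: "'v set"
    and N :: "'v \<Rightarrow> real"
  assumes nonzero: "nonzero_obs D \<noteq> {}"
    and nu_epi: "\<nu> \<in> epi (K0 D) (add_group \<Lambda>)"
begin

lemma nu_image: "\<nu> ` carrier (K0 D) = \<Lambda>"
  using nu_epi unfolding epi_def add_group_def by simp

lemma nu_in: "E \<in> Ob D \<Longrightarrow> \<nu> (K0_class D E) \<in> \<Lambda>"
  using nu_image K0_class_in by blast

lemma nonzero_obsD: "E \<in> nonzero_obs D \<Longrightarrow> E \<in> Ob D" "E \<in> nonzero_obs D \<Longrightarrow> \<not> zero_ob D E"
  unfolding nonzero_obs_def by auto

lemma nonzero_obs_isomorphic: "isomorphic D A B \<Longrightarrow> A \<in> nonzero_obs D \<Longrightarrow> B \<in> nonzero_obs D"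
  using zero_ob_isomorphic[of B A] isomorphic_sym[of A B] isomorphic_Ob(2)[of A B]
  unfolding nonzero_obs_def by blast

lemma Stab_slicing: "\<sigma> \<in> Stab D \<nu> \<Lambda> N \<Longrightarrow> slicing D (Slice \<sigma>)"
  unfolding Stab_def stability_condition_def slicing_def by blast

lemma Stab_HN_ex:
  assumes "\<sigma> \<in> Stab D \<nu> \<Lambda> N" "E \<in> nonzero_obs D"
  obtains xs where "HN_filtration D (Slice \<sigma>) E xs"
  using assms unfolding Stab_def stability_condition_def by blast

lemma HN_filtration_factor:
  assumes "HN_filtration D P E xs" "(A, \<phi>) \<in> set xs"
  shows "A \<in> P \<phi>" "\<not> zero_ob D A"
  using assms unfolding HN_filtration_def by auto

lemma HN_filtration_not_Nil: "HN_filtration D P E xs \<Longrightarrow> E \<in> nonzero_obs D \<Longrightarrow> xs \<noteq> []"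
  by (auto simp: HN_filtration_Nil dest: nonzero_obsD)

text \<open>Frees the invariants from the arbitrary choice in \<open>HN\<close>: any filtration at
  hand may be used to compute them.\<close>

lemma HN_invariants:
  assumes s: "slicing D (Slice \<sigma>)" and E: "E \<in> nonzero_obs D"
    and xs: "HN_filtration D (Slice \<sigma>) E xs"
  shows "mass_t D \<nu> \<sigma> t E = (\<Sum>(A, \<phi>) \<leftarrow> xs. cmod (Charge \<sigma> (\<nu> (K0_class D A))) * exp (\<phi> * t))"
    and "phase_max D \<sigma> E = snd (hd xs)" and "phase_min D \<sigma> E = snd (last xs)"
proof -
  have HN: "HN_filtration D (Slice \<sigma>) E (HN D \<sigma> E)" unfolding HN_def using xs by (rule someI)
  have u: "list_all2 (\<lambda>(A, \<phi>) (B, \<psi>). isomorphic D A B \<and> \<phi> = \<psi>) (HN D \<sigma> E) xs"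
    using HN_filtration_unique[OF s HN xs] isomorphic_refl nonzero_obsD(1)[OF E] by blast
  show "mass_t D \<nu> \<sigma> t E = (\<Sum>(A, \<phi>) \<leftarrow> xs. cmod (Charge \<sigma> (\<nu> (K0_class D A))) * exp (\<phi> * t))"
    unfolding mass_t_def using nonzero_obsD(2)[OF E]
    by (auto intro!: sum_list_list_all2 list_all2_mono[OF u] dest: K0_class_isomorphic)
  have ne: "HN D \<sigma> E \<noteq> []" "xs \<noteq> []" using HN xs HN_filtration_not_Nil E by auto
  have "list_all2 (\<lambda>x y. snd x = snd y) (HN D \<sigma> E) xs" using u by (rule list_all2_mono) auto
  then have "map snd (HN D \<sigma> E) = map snd xs" by (simp add: list_all2_conv_all_nth list_eq_iff_nth_eq)
  then show "phase_max D \<sigma> E = snd (hd xs)" "phase_min D \<sigma> E = snd (last xs)"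
    unfolding phase_max_def phase_min_def using ne by (metis hd_map, metis last_map)
qed

text \<open>Needed because a quasi-inverse recovers objects only up to isomorphism.\<close>

lemma invariants_isomorphic:
  assumes \<sigma>: "\<sigma> \<in> Stab D \<nu> \<Lambda> N" and E: "E \<in> nonzero_obs D" and iso: "isomorphic D E E'"
  shows "mass D \<nu> \<sigma> E = mass D \<nu> \<sigma> E'" "phase_max D \<sigma> E = phase_max D \<sigma> E'"
    "phase_min D \<sigma> E = phase_min D \<sigma> E'"
proof -
  obtain xs where xs: "HN_filtration D (Slice \<sigma>) E xs" using Stab_HN_ex \<sigma> E by blast
  have xs': "HN_filtration D (Slice \<sigma>) E' xs" using HN_filtration_isomorphic xs iso by blast
  note * = HN_invariants[OF Stab_slicing[OF \<sigma>] E xs]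
    HN_invariants[OF Stab_slicing[OF \<sigma>] nonzero_obs_isomorphic[OF iso E] xs']
  show "mass D \<nu> \<sigma> E = mass D \<nu> \<sigma> E'" "phase_max D \<sigma> E = phase_max D \<sigma> E'"
    "phase_min D \<sigma> E = phase_min D \<sigma> E'"
    using * by simp_all
qed

lemma mass_pos:
  assumes \<sigma>: "\<sigma> \<in> Stab D \<nu> \<Lambda> N" and E: "E \<in> nonzero_obs D"
  shows "0 < mass D \<nu> \<sigma> E"
proof -
  obtain xs where xs: "HN_filtration D (Slice \<sigma>) E xs" using Stab_HN_ex \<sigma> E by blast
  have pos: "0 < cmod (Charge \<sigma> (\<nu> (K0_class D A)))" if "(A, \<phi>) \<in> set xs" for A \<phi>
  proof -
    have "A \<in> Slice \<sigma> \<phi> \<inter> nonzero_obs D"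
      using HN_filtration_factor[OF xs that] slicing_Ob[OF Stab_slicing[OF \<sigma>]]
      unfolding nonzero_obs_def by blast
    then obtain m where "m > 0" "Charge \<sigma> (\<nu> (K0_class D A)) = of_real m * exp (\<i> * of_real (pi * \<phi>))"
      using \<sigma> unfolding Stab_def stability_condition_def by blast
    then show ?thesis by simp
  qed
  have "xs \<noteq> []" using HN_filtration_not_Nil xs E by blast
  then obtain B \<psi> ys where ys: "xs = (B, \<psi>) # ys" by (cases xs) auto
  have "0 \<le> (\<Sum>(A, \<phi>) \<leftarrow> ys. cmod (Charge \<sigma> (\<nu> (K0_class D A))))"
    by (rule sum_list_nonneg) auto
  then show ?thesis
    using HN_invariants(1)[OF Stab_slicing[OF \<sigma>] E xs, of 0] pos[of B \<psi>] ys by (simp add: add_pos_nonneg)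
qed

lemma c_act_c_act: "c_act \<Lambda> (c_act \<Lambda> \<sigma> w) v = c_act \<Lambda> \<sigma> (w + v)"
proof -
  have "exp (- \<i> * of_real pi * v) * exp (- \<i> * of_real pi * w) = exp (- \<i> * of_real pi * (w + v))"
    by (simp add: exp_add[symmetric] algebra_simps)
  then show ?thesis
    unfolding c_act_def by (auto simp: add.assoc add.left_commute add.commute fun_eq_iff mult.assoc[symmetric])
qed

lemma c_act_zero: "\<sigma> \<in> Stab D \<nu> \<Lambda> N \<Longrightarrow> c_act \<Lambda> \<sigma> 0 = \<sigma>"
  unfolding c_act_def Stab_def stability_condition_def by (simp add: extensional_restrict)

text \<open>A filtration for \<sigma> with all phases lowered by \<open>Re w\<close> is one for the
  translate, and |exp(-i pi w)| = exp(pi Im w).\<close>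

lemma c_act_invariants:
  assumes \<sigma>: "\<sigma> \<in> Stab D \<nu> \<Lambda> N" and E: "E \<in> nonzero_obs D"
  shows "mass D \<nu> (c_act \<Lambda> \<sigma> w) E = exp (pi * Im w) * mass D \<nu> \<sigma> E"
    and "phase_max D (c_act \<Lambda> \<sigma> w) E = phase_max D \<sigma> E - Re w"
    and "phase_min D (c_act \<Lambda> \<sigma> w) E = phase_min D \<sigma> E - Re w"
proof -
  obtain xs where xs: "HN_filtration D (Slice \<sigma>) E xs" using Stab_HN_ex \<sigma> E by blast
  let ?ys = "map (\<lambda>(A, \<phi>). (A, \<phi> - Re w)) xs"
  have "map (\<lambda>(A, \<phi>). (A, \<phi> + Re w)) ?ys = xs" by (simp add: o_def case_prod_beta)
  then have ys: "HN_filtration D (Slice (c_act \<Lambda> \<sigma> w)) E ?ys"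
    using xs by (simp add: c_act_def HN_filtration_shift)
  have s: "slicing D (Slice (c_act \<Lambda> \<sigma> w))"
    using slicing_shift[OF Stab_slicing[OF \<sigma>]] by (simp add: c_act_def)
  have "cmod (Charge (c_act \<Lambda> \<sigma> w) (\<nu> (K0_class D A))) = exp (pi * Im w) * cmod (Charge \<sigma> (\<nu> (K0_class D A)))"
    if "(A, \<phi>) \<in> set xs" for A \<phi>
  proof -
    have "\<nu> (K0_class D A) \<in> \<Lambda>"
      using nu_in slicing_Ob[OF Stab_slicing[OF \<sigma>]] HN_filtration_factor(1)[OF xs that] by blast
    then show ?thesis by (simp add: c_act_def norm_mult)
  qed
  then have "(\<Sum>(A, \<phi>) \<leftarrow> ?ys. cmod (Charge (c_act \<Lambda> \<sigma> w) (\<nu> (K0_class D A))))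
      = exp (pi * Im w) * (\<Sum>(A, \<phi>) \<leftarrow> xs. cmod (Charge \<sigma> (\<nu> (K0_class D A))))"
    by (simp add: sum_list_const_mult[symmetric] o_def case_prod_beta cong: map_cong)
       (rule arg_cong[where f = sum_list], auto intro!: map_cong)
  then show "mass D \<nu> (c_act \<Lambda> \<sigma> w) E = exp (pi * Im w) * mass D \<nu> \<sigma> E"
    using HN_invariants(1)[OF s E ys, of 0] HN_invariants(1)[OF Stab_slicing[OF \<sigma>] E xs, of 0] by simp
  have "xs \<noteq> []" using HN_filtration_not_Nil xs E by blast
  then show "phase_max D (c_act \<Lambda> \<sigma> w) E = phase_max D \<sigma> E - Re w"
    "phase_min D (c_act \<Lambda> \<sigma> w) E = phase_min D \<sigma> E - Re w"
    using HN_invariants(2,3)[OF s E ys] HN_invariants(2,3)[OF Stab_slicing[OF \<sigma>] E xs]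
    by (simp_all add: hd_map last_map case_prod_beta)
qed

section \<open>Auto-equivalences\<close>

lemma AutD:
  assumes "F \<in> Aut D \<nu> \<Lambda>"
  shows "exact_functor D F" "autoequivalence D F" "additive_functor D F" "is_endofunctor D F"
  using assms unfolding Aut_def exact_functor_def additive_functor_def by auto

text \<open>Legitimises the \<open>THE\<close> in \<open>lattice_action\<close>: two candidates
  induce the same map on \<open>K0 D\<close>, so they agree on the image of \<nu>, which is all of
  \<Lambda>, and both are extensional.\<close>

lemma descends_to_lattice_action:
  assumes F: "F \<in> Aut D \<nu> \<Lambda>"
  shows "descends_to D \<nu> \<Lambda> F (lattice_action D \<nu> \<Lambda> F)"
proof -
  obtain a where a: "descends_to D \<nu> \<Lambda> F a" using F unfolding Aut_def by blast
  have "b = a" if b: "descends_to D \<nu> \<Lambda> F b" for b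
  proof (rule extensionalityI)
    show "b \<in> extensional \<Lambda>" "a \<in> extensional \<Lambda>" using a b unfolding descends_to_def by auto
    obtain k where k: "k \<in> hom (K0 D) (K0 D)" "\<forall>E \<in> Ob D. k (K0_class D E) = K0_class D (fob F E)"
        "\<forall>x \<in> carrier (K0 D). a (\<nu> x) = \<nu> (k x)"
      using a unfolding descends_to_def by blast
    obtain l where l: "l \<in> hom (K0 D) (K0 D)" "\<forall>E \<in> Ob D. l (K0_class D E) = K0_class D (fob F E)"
        "\<forall>x \<in> carrier (K0 D). b (\<nu> x) = \<nu> (l x)"
      using b unfolding descends_to_def by blast
    fix y assume "y \<in> \<Lambda>"
    then obtain x where x: "x \<in> carrier (K0 D)" "y = \<nu> x" using nu_image by blast
    have "l x = k x" using K0_hom_eqI[OF l(1) k(1) group_K0 _ x(1)] k l by simp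
    then show "b y = a y" using x k l by simp
  qed
  then show ?thesis unfolding lattice_action_def using a by (metis theI)
qed

lemma lattice_action:
  assumes F: "F \<in> Aut D \<nu> \<Lambda>"
  shows "bij_betw (lattice_action D \<nu> \<Lambda> F) \<Lambda> \<Lambda>"
    "E \<in> Ob D \<Longrightarrow> lattice_action D \<nu> \<Lambda> F (\<nu> (K0_class D E)) = \<nu> (K0_class D (fob F E))"
proof -
  show "bij_betw (lattice_action D \<nu> \<Lambda> F) \<Lambda> \<Lambda>"
    using descends_to_lattice_action[OF F] unfolding descends_to_def iso_def add_group_def by simp
  show "E \<in> Ob D \<Longrightarrow> lattice_action D \<nu> \<Lambda> F (\<nu> (K0_class D E)) = \<nu> (K0_class D (fob F E))"
    using descends_to_lattice_action[OF F] K0_class_in unfolding descends_to_def by auto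
qed

lemma aut_act_Charge:
  assumes F: "F \<in> Aut D \<nu> \<Lambda>" and E: "E \<in> Ob D"
  shows "Charge (aut_act D \<nu> \<Lambda> F \<sigma>) (\<nu> (K0_class D (fob F E))) = Charge \<sigma> (\<nu> (K0_class D E))"
proof -
  have "\<nu> (K0_class D (fob F E)) \<in> \<Lambda>" using nu_in functor_Ob[OF AutD(4)[OF F] E] by blast
  moreover have "inv_into \<Lambda> (lattice_action D \<nu> \<Lambda> F) (\<nu> (K0_class D (fob F E))) = \<nu> (K0_class D E)"
    using lattice_action[OF F] E nu_in[OF E] by (metis bij_betw_inv_into_left)
  ultimately show ?thesis unfolding aut_act_def by simp
qed

lemma aut_act_c_act:
  assumes F: "F \<in> Aut D \<nu> \<Lambda>"
  shows "aut_act D \<nu> \<Lambda> F (c_act \<Lambda> \<sigma> w) = c_act \<Lambda> (aut_act D \<nu> \<Lambda> F \<sigma>) w"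
proof -
  have "inv_into \<Lambda> (lattice_action D \<nu> \<Lambda> F) x \<in> \<Lambda>" if "x \<in> \<Lambda>" for x
    using that bij_betw_inv_into[OF lattice_action(1)[OF F]] unfolding bij_betw_def by blast
  then show ?thesis unfolding aut_act_def c_act_def by (auto simp: fun_eq_iff)
qed

lemma exact_functor_triangle:
  assumes F: "exact_functor D F" and t: "triangle D X Y Z t"
  shows "\<exists>t. triangle D (fob F X) (fob F Y) (fob F Z) t"
proof -
  obtain f g h where fgh: "triangle D X Y Z (f, g, h)" using t by (cases t) auto
  note hom = triangle_Hom[OF fgh]
  obtain \<eta> where \<eta>: "natural_iso D (comp_functor F (Shift D)) (comp_functor (Shift D) F) \<eta>"
      "(farr F f, farr F g, \<eta> X \<cdot> farr F h) \<in> Tri D"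
    using F fgh unfolding exact_functor_def by blast
  have "\<eta> X \<in> Hom D (fob F (sh_ob D X)) (sh_ob D (fob F X))"
    using \<eta>(1) triangle_Ob(1)[OF t] unfolding natural_iso_def iso_arr_def comp_functor_def by simp
  moreover have "farr F f \<in> Hom D (fob F X) (fob F Y)" "farr F g \<in> Hom D (fob F Y) (fob F Z)"
    "farr F h \<in> Hom D (fob F Z) (fob F (sh_ob D X))"
    using F hom unfolding exact_functor_def additive_functor_def is_endofunctor_def by blast+
  ultimately show ?thesis
    using \<eta>(2) Comp_in unfolding triangle_def candidate_def by fast
qed

text \<open>Exactness transports the triangles, and since an auto-equivalence reflects zero objects
  no factor is lost.\<close>

lemma aut_act_HN_filtration:
  assumes F: "F \<in> Aut D \<nu> \<Lambda>" and s: "slicing D (Slice \<sigma>)" and "HN_filtration D (Slice \<sigma>) E xs"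
  shows "HN_filtration D (Slice (aut_act D \<nu> \<Lambda> F \<sigma>)) (fob F E) (map (\<lambda>(A, \<phi>). (fob F A, \<phi>)) xs)"
  using assms(3)
proof (induction xs arbitrary: E rule: rev_induct)
  case Nil
  then show ?case using additive_functor_zero_ob[OF AutD(3)[OF F]] by (simp add: HN_filtration_Nil)
next
  case (snoc x xs)
  obtain A \<phi> where x: "x = (A, \<phi>)" by (cases x)
  obtain X t where X: "HN_filtration D (Slice \<sigma>) X xs" "triangle D X E A t"
    and A: "A \<in> Slice \<sigma> \<phi>" "\<not> zero_ob D A" "\<forall>x \<in> set xs. \<phi> < snd x"
    using snoc.prems unfolding x HN_filtration_snoc by blast
  have Aob: "A \<in> Ob D" using slicing_Ob[OF s A(1)] .
  have "fob F A \<in> Ob D" using functor_Ob[OF AutD(4)[OF F] Aob] .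
  then have "fob F A \<in> Slice (aut_act D \<nu> \<Lambda> F \<sigma>) \<phi>"
    using A(1) isomorphic_refl unfolding aut_act_def iso_closure_def by auto
  moreover have "\<not> zero_ob D (fob F A)"
    using autoequivalence_zero_ob_iff[OF AutD(3,2)[OF F] Aob] A(2) by blast
  moreover obtain t' where "triangle D (fob F X) (fob F E) (fob F A) t'"
    using exact_functor_triangle[OF AutD(1)[OF F] X(2)] by blast
  ultimately show ?case
    using snoc.IH[OF X(1)] A(3) by (auto simp: x HN_filtration_snoc simp del: split_paired_Ex intro: exI)
qed

lemma aut_act_invariants:
  assumes F: "F \<in> Aut D \<nu> \<Lambda>" and \<sigma>: "\<sigma> \<in> Stab D \<nu> \<Lambda> N" "aut_act D \<nu> \<Lambda> F \<sigma> \<in> Stab D \<nu> \<Lambda> N"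
    and E: "E \<in> nonzero_obs D"
  shows "fob F E \<in> nonzero_obs D"
    and "mass D \<nu> (aut_act D \<nu> \<Lambda> F \<sigma>) (fob F E) = mass D \<nu> \<sigma> E"
    and "phase_max D (aut_act D \<nu> \<Lambda> F \<sigma>) (fob F E) = phase_max D \<sigma> E"
    and "phase_min D (aut_act D \<nu> \<Lambda> F \<sigma>) (fob F E) = phase_min D \<sigma> E"
proof -
  show FE: "fob F E \<in> nonzero_obs D"
    using E autoequivalence_zero_ob_iff[OF AutD(3,2)[OF F]] functor_Ob[OF AutD(4)[OF F]]
    unfolding nonzero_obs_def by blast
  obtain xs where xs: "HN_filtration D (Slice \<sigma>) E xs" using Stab_HN_ex \<sigma> E by blast
  note s = Stab_slicing[OF \<sigma>(1)] Stab_slicing[OF \<sigma>(2)]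
  note Fxs = aut_act_HN_filtration[OF F s(1) xs]
  have "Charge (aut_act D \<nu> \<Lambda> F \<sigma>) (\<nu> (K0_class D (fob F A))) = Charge \<sigma> (\<nu> (K0_class D A))"
    if "(A, \<phi>) \<in> set xs" for A \<phi>
    using aut_act_Charge[OF F] slicing_Ob[OF s(1)] HN_filtration_factor(1)[OF xs that] by blast
  then show "mass D \<nu> (aut_act D \<nu> \<Lambda> F \<sigma>) (fob F E) = mass D \<nu> \<sigma> E"
    using HN_invariants(1)[OF s(2) FE Fxs, of 0] HN_invariants(1)[OF s(1) E xs, of 0]
    by (auto simp: o_def case_prod_beta intro!: arg_cong[where f = sum_list] map_cong)
  have "xs \<noteq> []" using HN_filtration_not_Nil xs E by blast
  then show "phase_max D (aut_act D \<nu> \<Lambda> F \<sigma>) (fob F E) = phase_max D \<sigma> E"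
    "phase_min D (aut_act D \<nu> \<Lambda> F \<sigma>) (fob F E) = phase_min D \<sigma> E"
    using HN_invariants(2,3)[OF s(2) FE Fxs] HN_invariants(2,3)[OF s(1) E xs]
    by (simp_all add: hd_map last_map case_prod_beta)
qed

end

section \<open>Growth of real sequences\<close>

text \<open>After subtracting the expected slope, the sequence decreases along each residue class
  modulo \<open>n\<close>, so its first \<open>n\<close> values bound it. Serves both the growth
  estimate and, with \<open>c = u n\<close>, Fekete's argument.\<close>

lemma linear_bound_of_step:
  fixes u :: "nat \<Rightarrow> real"
  assumes n: "0 < n" and step: "\<And>k. u (k + n) \<le> u k + c"
  shows "\<exists>M. \<forall>k. u k \<le> M + real k * (c / real n)"
proof -
  define v where "v k = u k - real k * (c / real n)" for k
  have v: "v (k + n) \<le> v k" for k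
  proof -
    have "real (k + n) * (c / real n) = real k * (c / real n) + c" using n by (simp add: field_simps)
    then show ?thesis using step[of k] by (simp add: v_def)
  qed
  have "v k \<le> Max (v ` {..<n})" for k
  proof (induction k rule: less_induct)
    case (less k)
    show ?case
    proof (cases "k < n")
      case False
      then have "v k \<le> v (k - n)" using v[of "k - n"] by simp
      also have "\<dots> \<le> Max (v ` {..<n})" using less[of "k - n"] False n by simp
      finally show ?thesis .
    qed auto
  qed
  then show ?thesis
    by (intro exI[of _ "Max (v ` {..<n})"]) (simp add: v_def algebra_simps)
qed

lemma limsup_le_of_step:
  fixes u :: "nat \<Rightarrow> real"
  assumes n: "0 < n" and step: "\<And>k. u (k + n) \<le> u k + c"
  shows "limsup (\<lambda>k. ereal (u k) / ereal (real k)) \<le> ereal (c / real n)"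
proof -
  obtain M where M: "\<And>k. u k \<le> M + real k * (c / real n)" using linear_bound_of_step assms by blast
  have "\<forall>\<^sub>F k in sequentially. ereal (u k) / ereal (real k) \<le> ereal (M / real k + c / real n)"
    using eventually_gt_at_top[of 0]
  proof eventually_elim
    case (elim k)
    have "u k / real k \<le> (M + real k * (c / real n)) / real k"
      using M elim by (intro divide_right_mono) auto
    also have "\<dots> = M / real k + c / real n" using elim by (simp add: add_divide_distrib)
    finally show ?case using elim by simp
  qed
  then have "limsup (\<lambda>k. ereal (u k) / ereal (real k)) \<le> limsup (\<lambda>k. ereal (M / real k + c / real n))"
    by (rule Limsup_mono)
  also have "(\<lambda>k. M / real k + c / real n) \<longlonglongrightarrow> 0 + c / real n"
    by (intro tendsto_intros lim_const_over_n)
  then have "limsup (\<lambda>k. ereal (M / real k + c / real n)) = ereal (c / real n)"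
    by (intro lim_imp_Limsup) auto
  finally show ?thesis .
qed

text \<open>Fekete: the limit is the infimum of the quotients at positive indices, which is real
  because they are non-negative.\<close>

lemma subadditive_convergent:
  fixes u :: "nat \<Rightarrow> real"
  assumes nonneg: "\<And>n. 0 \<le> u n" and sub: "\<And>m n. u (m + n) \<le> u m + u n"
  shows "\<exists>l. (\<lambda>n. u n / real n) \<longlonglongrightarrow> l"
proof -
  define A where "A = (\<lambda>n. u n / real n) ` {0<..}"
  have A: "A \<noteq> {}" "bdd_below A"
    using nonneg unfolding A_def by (auto intro!: bdd_belowI2[of _ 0])
  have "(\<lambda>n. u n / real n) \<longlonglongrightarrow> Inf A"
  proof (rule LIMSEQ_I)
    fix r :: real assume r: "0 < r"
    then obtain N where N: "0 < N" "u N / real N < Inf A + r / 2"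
      using cInf_lessD[OF A(1), of "Inf A + r / 2"] unfolding A_def by auto
    obtain M where M: "\<And>k. u k \<le> M + real k * (u N / real N)"
      using linear_bound_of_step[of N u "u N"] N(1) sub by blast
    \<comment> \<open>Beyond \<open>K\<close> the bounded error \<open>M\<close> contributes less
      than r/2; the other r/2 went into the choice of \<open>N\<close>.\<close>
    obtain K :: nat where K: "2 * \<bar>M\<bar> / r < real K" using reals_Archimedean2 by blast
    have "norm (u n / real n - Inf A) < r" if n: "n \<ge> Suc K" for n
    proof -
      have n0: "0 < real n" using n by simp
      have "2 * \<bar>M\<bar> / r < real n" using K n by simp
      then have "\<bar>M\<bar> / real n < r / 2" using r n0 by (simp add: field_simps)
      then have 1: "M / real n < r / 2"
        using divide_right_mono[of M "\<bar>M\<bar>" "real n"] n0 by linarith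
      have "u n / real n \<le> (M + real n * (u N / real N)) / real n"
        using M n0 by (intro divide_right_mono) auto
      also have "\<dots> = M / real n + u N / real N" using n0 by (simp add: add_divide_distrib)
      finally have "u n / real n < Inf A + r" using 1 N by linarith
      moreover have "Inf A \<le> u n / real n"
        using A(2) n0 unfolding A_def by (intro cInf_lower) auto
      ultimately show ?thesis using r by simp
    qed
    then show "\<exists>no. \<forall>n\<ge>no. norm (u n / real n - Inf A) < r" by blast
  qed
  then show ?thesis by blast
qed

section \<open>The distance between orbits\<close>

lemma Max_add_le:
  fixes x y z :: real
  assumes "x \<le> x' + x''" "y \<le> y' + y''" "z \<le> z' + z''"
  shows "Max {x, y, z} \<le> Max {x', y', z'} + Max {x'', y'', z''}"
proof (rule Max.boundedI)
  fix w assume "w \<in> {x, y, z}"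
  moreover have "a + b \<le> Max {x', y', z'} + Max {x'', y'', z''}"
    if "a \<in> {x', y', z'}" "b \<in> {x'', y'', z''}" for a b
    using that by (intro add_mono Max_ge) auto
  ultimately show "w \<le> Max {x', y', z'} + Max {x'', y'', z''}" using assms by fastforce
qed auto

context stability_setting
begin

text \<open>The condition under which logarithms of mass quotients split into differences. It is
  separate from \<open>Stab\<close> because for translates it follows directly from the formula for
  their masses.\<close>

definition mass_positive :: "('o, 'v) stab \<Rightarrow> bool" where
  "mass_positive \<sigma> \<longleftrightarrow> (\<forall>E \<in> nonzero_obs D. 0 < mass D \<nu> \<sigma> E)"

lemma mass_positive_c_act: "\<sigma> \<in> Stab D \<nu> \<Lambda> N \<Longrightarrow> mass_positive (c_act \<Lambda> \<sigma> w)"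
  unfolding mass_positive_def by (simp add: c_act_invariants mass_pos)

lemma mass_positive_Stab: "\<sigma> \<in> Stab D \<nu> \<Lambda> N \<Longrightarrow> mass_positive \<sigma>"
  unfolding mass_positive_def by (simp add: mass_pos)

lemma stab_dist_self:
  assumes "mass_positive \<sigma>"
  shows "stab_dist D \<nu> \<sigma> \<sigma> = 0"
proof -
  have "stab_dist D \<nu> \<sigma> \<sigma> = (SUP E \<in> nonzero_obs D. 0)"
    unfolding stab_dist_def using assms by (intro SUP_cong) (auto simp: mass_positive_def)
  then show ?thesis using nonzero by simp
qed

text \<open>A non-zero object has to exist: a supremum over the empty set would be minus
  infinity.\<close>

lemma stab_dist_nonneg: "0 \<le> stab_dist D \<nu> \<sigma> \<tau>"
proof -
  obtain E where E: "E \<in> nonzero_obs D" using nonzero by blast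
  show ?thesis unfolding stab_dist_def by (rule SUP_upper2[OF E]) (simp add: le_max_iff_disj)
qed

lemma stab_dist_sym:
  assumes "mass_positive \<sigma>" "mass_positive \<tau>"
  shows "stab_dist D \<nu> \<sigma> \<tau> = stab_dist D \<nu> \<tau> \<sigma>"
  unfolding stab_dist_def
proof (rule SUP_cong[OF refl])
  fix E assume E: "E \<in> nonzero_obs D"
  have "\<bar>ln (mass D \<nu> \<sigma> E / mass D \<nu> \<tau> E)\<bar> = \<bar>ln (mass D \<nu> \<tau> E / mass D \<nu> \<sigma> E)\<bar>"
    using assms E unfolding mass_positive_def by (simp add: ln_div abs_minus_commute)
  then show "ereal (Max {\<bar>ln (mass D \<nu> \<sigma> E / mass D \<nu> \<tau> E)\<bar>, \<bar>phase_max D \<sigma> E - phase_max D \<tau> E\<bar>,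
      \<bar>phase_min D \<sigma> E - phase_min D \<tau> E\<bar>}) =
    ereal (Max {\<bar>ln (mass D \<nu> \<tau> E / mass D \<nu> \<sigma> E)\<bar>, \<bar>phase_max D \<tau> E - phase_max D \<sigma> E\<bar>,
      \<bar>phase_min D \<tau> E - phase_min D \<sigma> E\<bar>})"
    by (simp add: abs_minus_commute)
qed

lemma stab_dist_triangle:
  assumes "mass_positive \<sigma>" "mass_positive \<tau>" "mass_positive \<rho>"
  shows "stab_dist D \<nu> \<sigma> \<rho> \<le> stab_dist D \<nu> \<sigma> \<tau> + stab_dist D \<nu> \<tau> \<rho>"
proof -
  let ?d = "\<lambda>\<sigma> \<tau> E. Max {\<bar>ln (mass D \<nu> \<sigma> E / mass D \<nu> \<tau> E)\<bar>, \<bar>phase_max D \<sigma> E - phase_max D \<tau> E\<bar>,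
      \<bar>phase_min D \<sigma> E - phase_min D \<tau> E\<bar>}"
  have "ereal (?d \<sigma> \<rho> E) \<le> stab_dist D \<nu> \<sigma> \<tau> + stab_dist D \<nu> \<tau> \<rho>" if E: "E \<in> nonzero_obs D" for E
  proof -
    have "?d \<sigma> \<rho> E \<le> ?d \<sigma> \<tau> E + ?d \<tau> \<rho> E"
      using assms E unfolding mass_positive_def by (intro Max_add_le) (auto simp: ln_div)
    then have "ereal (?d \<sigma> \<rho> E) \<le> ereal (?d \<sigma> \<tau> E) + ereal (?d \<tau> \<rho> E)"
      by (simp only: plus_ereal.simps ereal_less_eq)
    also have "\<dots> \<le> stab_dist D \<nu> \<sigma> \<tau> + stab_dist D \<nu> \<tau> \<rho>"
      unfolding stab_dist_def using E by (intro add_mono SUP_upper)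
    finally show ?thesis .
  qed
  then show ?thesis unfolding stab_dist_def[of D \<nu> \<sigma> \<rho>] by (rule SUP_least)
qed

lemma stab_dist_ge_ln_mass:
  assumes "E \<in> nonzero_obs D"
  shows "ereal \<bar>ln (mass D \<nu> \<sigma> E / mass D \<nu> \<tau> E)\<bar> \<le> stab_dist D \<nu> \<sigma> \<tau>"
  unfolding stab_dist_def by (rule SUP_upper2[OF assms]) simp

text \<open>The common factor exp(pi Im w) cancels in mass quotients and the common
  \<open>Re w\<close> in phase differences. The extra \<open>a\<close> is what allows a change of
  representatives under an infimum.\<close>

lemma stab_dist_c_act:
  assumes "\<sigma> \<in> Stab D \<nu> \<Lambda> N" "\<tau> \<in> Stab D \<nu> \<Lambda> N"
  shows "stab_dist D \<nu> (c_act \<Lambda> \<sigma> w) (c_act \<Lambda> \<tau> (w + a)) = stab_dist D \<nu> \<sigma> (c_act \<Lambda> \<tau> a)"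
  unfolding stab_dist_def
  using assms by (intro SUP_cong refl)
    (simp add: c_act_invariants algebra_simps exp_add mult.assoc)

text \<open>Up to isomorphism every \<open>E\<close> is the image of \<open>fob H E\<close>, so each
  term on the left occurs on the right. Non-expansion is all that the later estimates draw on, and
  carrying \<open>a\<close> lets it pass to orbits.\<close>

lemma stab_dist_le_aut_act:
  assumes F: "F \<in> Aut D \<nu> \<Lambda>"
    and \<sigma>: "\<sigma> \<in> Stab D \<nu> \<Lambda> N" "aut_act D \<nu> \<Lambda> F \<sigma> \<in> Stab D \<nu> \<Lambda> N"
    and \<tau>: "\<tau> \<in> Stab D \<nu> \<Lambda> N" "aut_act D \<nu> \<Lambda> F \<tau> \<in> Stab D \<nu> \<Lambda> N"
  shows "stab_dist D \<nu> (aut_act D \<nu> \<Lambda> F \<sigma>) (c_act \<Lambda> (aut_act D \<nu> \<Lambda> F \<tau>) a) \<le> stab_dist D \<nu> \<sigma> (c_act \<Lambda> \<tau> a)"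
  unfolding stab_dist_def
proof (rule SUP_mono)
  fix E assume E: "E \<in> nonzero_obs D"
  obtain H where H: "quasi_inverse D F H" using AutD(2)[OF F] unfolding autoequivalence_def by blast
  let ?E = "fob H E"
  have Eob: "E \<in> Ob D" using nonzero_obsD E by blast
  have iso: "isomorphic D (fob F ?E) E" using quasi_inverse_isomorphic[OF H Eob] by blast
  have FE: "fob F ?E \<in> nonzero_obs D" using nonzero_obs_isomorphic[OF isomorphic_sym[OF iso] E] .
  have "?E \<in> Ob D" using H Eob functor_Ob unfolding quasi_inverse_def by blast
  then have E': "?E \<in> nonzero_obs D"
    using FE autoequivalence_zero_ob_iff[OF AutD(3,2)[OF F]] unfolding nonzero_obs_def by blast
  note s = invariants_isomorphic[OF \<sigma>(2) FE iso] aut_act_invariants[OF F \<sigma> E']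
    and t = invariants_isomorphic[OF \<tau>(2) FE iso] aut_act_invariants[OF F \<tau> E']
  show "\<exists>E'\<in>nonzero_obs D.
    ereal (Max {\<bar>ln (mass D \<nu> (aut_act D \<nu> \<Lambda> F \<sigma>) E / mass D \<nu> (c_act \<Lambda> (aut_act D \<nu> \<Lambda> F \<tau>) a) E)\<bar>,
      \<bar>phase_max D (aut_act D \<nu> \<Lambda> F \<sigma>) E - phase_max D (c_act \<Lambda> (aut_act D \<nu> \<Lambda> F \<tau>) a) E\<bar>,
      \<bar>phase_min D (aut_act D \<nu> \<Lambda> F \<sigma>) E - phase_min D (c_act \<Lambda> (aut_act D \<nu> \<Lambda> F \<tau>) a) E\<bar>})
    \<le> ereal (Max {\<bar>ln (mass D \<nu> \<sigma> E' / mass D \<nu> (c_act \<Lambda> \<tau> a) E')\<bar>,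
      \<bar>phase_max D \<sigma> E' - phase_max D (c_act \<Lambda> \<tau> a) E'\<bar>,
      \<bar>phase_min D \<sigma> E' - phase_min D (c_act \<Lambda> \<tau> a) E'\<bar>})"
    using E' E s t \<sigma> \<tau> by (intro bexI[of _ ?E]) (simp_all add: c_act_invariants)
qed

text \<open>The value of \<open>quot_dist\<close> on the orbits of \<sigma> and \<tau>, computed
  from these given points instead of from chosen representatives.\<close>

definition orbit_dist :: "('o, 'v) stab \<Rightarrow> ('o, 'v) stab \<Rightarrow> ereal" where
  "orbit_dist \<sigma> \<tau> = (INF a. stab_dist D \<nu> \<sigma> (c_act \<Lambda> \<tau> a))"

lemma orbit_dist_nonneg: "0 \<le> orbit_dist \<sigma> \<tau>"
  unfolding orbit_dist_def by (rule INF_greatest) (rule stab_dist_nonneg)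

lemma orbit_dist_le: "\<tau> \<in> Stab D \<nu> \<Lambda> N \<Longrightarrow> orbit_dist \<sigma> \<tau> \<le> stab_dist D \<nu> \<sigma> \<tau>"
  unfolding orbit_dist_def by (rule INF_lower2[of 0]) (simp_all add: c_act_zero)

text \<open>The chosen representatives are translates by some \<open>v\<close> and \<open>w\<close>.
  By invariance they only displace the parameter of the infimum by w - v, and this is a bijection of
  the complex numbers.\<close>

lemma quot_dist_orbits:
  assumes \<sigma>: "\<sigma> \<in> Stab D \<nu> \<Lambda> N" and \<tau>: "\<tau> \<in> Stab D \<nu> \<Lambda> N"
  shows "quot_dist D \<nu> \<Lambda> (c_orbit \<Lambda> \<sigma>) (c_orbit \<Lambda> \<tau>) = orbit_dist \<sigma> \<tau>"
proof -
  have rep: "\<exists>w. (SOME \<rho>. \<rho> \<in> c_orbit \<Lambda> \<rho>') = c_act \<Lambda> \<rho>' w" for \<rho>' :: "('o, 'v) stab"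
    using someI_ex[of "\<lambda>\<rho>. \<rho> \<in> c_orbit \<Lambda> \<rho>'"] unfolding c_orbit_def by blast
  obtain v w where vw: "(SOME \<rho>. \<rho> \<in> c_orbit \<Lambda> \<sigma>) = c_act \<Lambda> \<sigma> v" "(SOME \<rho>. \<rho> \<in> c_orbit \<Lambda> \<tau>) = c_act \<Lambda> \<tau> w"
    using rep by blast
  have eq: "stab_dist D \<nu> (c_act \<Lambda> \<sigma> v) (c_act \<Lambda> (c_act \<Lambda> \<tau> w) a) = stab_dist D \<nu> \<sigma> (c_act \<Lambda> \<tau> (a + (w - v)))" for a
    using stab_dist_c_act[OF \<sigma> \<tau>, of v "a + (w - v)"] by (simp add: c_act_c_act algebra_simps)
  have "quot_dist D \<nu> \<Lambda> (c_orbit \<Lambda> \<sigma>) (c_orbit \<Lambda> \<tau>)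
      = Inf ((\<lambda>b. stab_dist D \<nu> \<sigma> (c_act \<Lambda> \<tau> b)) ` range (\<lambda>a. a + (w - v)))"
    unfolding quot_dist_def vw eq image_image ..
  then show ?thesis unfolding orbit_dist_def by (simp only: surj_plus_right)
qed

text \<open>Translations are isometries, so an approximation of the second distance by parameter
  \<open>b\<close> can be moved by \<open>a\<close> to start where the first one ends.\<close>

lemma orbit_dist_triangle:
  assumes \<sigma>: "\<sigma> \<in> Stab D \<nu> \<Lambda> N" and \<tau>: "\<tau> \<in> Stab D \<nu> \<Lambda> N" and \<rho>: "\<rho> \<in> Stab D \<nu> \<Lambda> N"
  shows "orbit_dist \<sigma> \<rho> \<le> orbit_dist \<sigma> \<tau> + orbit_dist \<tau> \<rho>"
proof -
  have *: "orbit_dist \<sigma> \<rho> \<le> stab_dist D \<nu> \<sigma> (c_act \<Lambda> \<tau> a) + stab_dist D \<nu> \<tau> (c_act \<Lambda> \<rho> b)" for a b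
  proof -
    have "orbit_dist \<sigma> \<rho> \<le> stab_dist D \<nu> \<sigma> (c_act \<Lambda> \<rho> (a + b))"
      unfolding orbit_dist_def by (rule INF_lower) simp
    also have "\<dots> \<le> stab_dist D \<nu> \<sigma> (c_act \<Lambda> \<tau> a) + stab_dist D \<nu> (c_act \<Lambda> \<tau> a) (c_act \<Lambda> \<rho> (a + b))"
      using assms by (intro stab_dist_triangle mass_positive_Stab mass_positive_c_act)
    finally show ?thesis using stab_dist_c_act[OF \<tau> \<rho>] by simp
  qed
  \<comment> \<open>The infimum is taken over \<open>b\<close> first and over \<open>a\<close>
    afterwards. Pulling it through a sum of extended reals requires non-negativity, to keep minus
    infinity away.\<close>
  have "orbit_dist \<sigma> \<rho> \<le> stab_dist D \<nu> \<sigma> (c_act \<Lambda> \<tau> a) + orbit_dist \<tau> \<rho>" for a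
    unfolding orbit_dist_def[of \<tau> \<rho>] using stab_dist_nonneg[of \<sigma> "c_act \<Lambda> \<tau> a"]
    by (subst INF_ereal_add_right[symmetric]) (auto intro!: INF_greatest * stab_dist_nonneg)
  then show ?thesis
    unfolding orbit_dist_def[of \<sigma> \<tau>] using orbit_dist_nonneg[of \<tau> \<rho>]
    by (subst INF_ereal_add_left[symmetric]) (auto intro!: INF_greatest stab_dist_nonneg orbit_dist_nonneg)
qed

end

section \<open>Growth and displacement\<close>

context stability_setting
begin

section \<open>Finiteness of the distance on a connected component\<close>

lemma stab_topology_topspace: "topspace (stab_topology D \<nu> \<Lambda> N) \<subseteq> Stab D \<nu> \<Lambda> N"
  unfolding stab_topology_def topology_generated_by_topspace by blast

lemma openin_stab_ball:
  "\<sigma> \<in> Stab D \<nu> \<Lambda> N \<Longrightarrow> 0 < r \<Longrightarrow>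
    openin (stab_topology D \<nu> \<Lambda> N) {\<tau> \<in> Stab D \<nu> \<Lambda> N. stab_dist D \<nu> \<sigma> \<tau> < ereal r}"
  unfolding stab_topology_def by (rule topology_generated_by_Basis) blast

lemma stab_dist_finite_on_component:
  assumes S: "S \<in> connected_components_of (stab_topology D \<nu> \<Lambda> N)" and \<sigma>: "\<sigma> \<in> S" and \<tau>: "\<tau> \<in> S"
  shows "stab_dist D \<nu> \<sigma> \<tau> < \<infinity>"
proof (rule ccontr)
  assume inf: "\<not> stab_dist D \<nu> \<sigma> \<tau> < \<infinity>"
  let ?T = "stab_topology D \<nu> \<Lambda> N" and ?St = "Stab D \<nu> \<Lambda> N"
  define U where "U = {\<rho> \<in> ?St. stab_dist D \<nu> \<sigma> \<rho> < \<infinity>}"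
  define V where "V = {\<rho> \<in> ?St. stab_dist D \<nu> \<sigma> \<rho> = \<infinity>}"
  have con: "connectedin ?T S" using connectedin_connected_components_of[OF S] .
  have sub: "S \<subseteq> ?St" using connectedin_subset_topspace[OF con] stab_topology_topspace by blast
  note pos = mass_positive_Stab
  have "U = (\<Union>r \<in> {0<..}. {\<rho> \<in> ?St. stab_dist D \<nu> \<sigma> \<rho> < ereal r})" (is "_ = ?W")
  proof
    show "U \<subseteq> ?W"
    proof
      fix \<rho> assume \<rho>: "\<rho> \<in> U"
      then obtain d where d: "stab_dist D \<nu> \<sigma> \<rho> = ereal d" "0 \<le> d"
        using stab_dist_nonneg[of \<sigma> \<rho>] unfolding U_def by (cases "stab_dist D \<nu> \<sigma> \<rho>") auto
      then show "\<rho> \<in> ?W" using \<rho> unfolding U_def by (auto intro!: bexI[of _ "d + 1"])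
    qed
    show "?W \<subseteq> U" unfolding U_def by (auto intro: less_trans)
  qed
  moreover have "openin ?T ?W"
    using \<sigma> sub by (intro openin_Union) (auto intro!: openin_stab_ball)
  ultimately have "openin ?T U" by simp
  \<comment> \<open>Radius 1 is arbitrary: any finite displacement leaves an infinite distance
    infinite.\<close>
  have "V = (\<Union>\<rho> \<in> V. {\<pi> \<in> ?St. stab_dist D \<nu> \<rho> \<pi> < ereal 1})" (is "_ = ?W")
  proof
    show "V \<subseteq> ?W" using stab_dist_self[OF pos] unfolding V_def by force
    show "?W \<subseteq> V"
    proof clarify
      fix \<rho> \<pi> assume \<rho>: "\<rho> \<in> V" and \<pi>: "\<pi> \<in> ?St" "stab_dist D \<nu> \<rho> \<pi> < ereal 1"
      then have "stab_dist D \<nu> \<sigma> \<rho> \<le> stab_dist D \<nu> \<sigma> \<pi> + stab_dist D \<nu> \<rho> \<pi>"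
        using stab_dist_triangle[of \<sigma> \<pi> \<rho>] stab_dist_sym[of \<pi> \<rho>] pos sub \<sigma> unfolding V_def by auto
      then show "\<pi> \<in> V" using \<rho> \<pi> unfolding V_def by auto
    qed
  qed
  moreover have "openin ?T ?W"
    by (intro openin_Union) (auto intro!: openin_stab_ball simp: V_def)
  ultimately have "openin ?T V" by simp
  have "S \<subseteq> U \<union> V" "U \<inter> V \<inter> S = {}" using sub unfolding U_def V_def by auto
  moreover have "\<sigma> \<in> U \<inter> S" "\<tau> \<in> V \<inter> S"
    using stab_dist_self[OF pos] sub \<sigma> \<tau> inf unfolding U_def V_def by auto
  ultimately show False using con \<open>openin ?T U\<close> \<open>openin ?T V\<close> unfolding connectedin by blast
qed

section \<open>Iterates of the action and existence of the eventual displacement\<close>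

context
  fixes S :: "('o, 'v) stab set" and F :: "('o, 'm) endofunctor"
  assumes S: "S \<in> connected_components_of (stab_topology D \<nu> \<Lambda> N)"
    and F: "F \<in> Aut_component D \<nu> \<Lambda> S"
begin

lemma component_Stab: "\<sigma> \<in> S \<Longrightarrow> \<sigma> \<in> Stab D \<nu> \<Lambda> N"
  using connectedin_subset_topspace[OF connectedin_connected_components_of[OF S]] stab_topology_topspace
  by blast

lemma F_Aut: "F \<in> Aut D \<nu> \<Lambda>"
  using F unfolding Aut_component_def by blast

lemma aut_act_funpow_in: "\<sigma> \<in> S \<Longrightarrow> (aut_act D \<nu> \<Lambda> F ^^ n) \<sigma> \<in> S"
  using F unfolding Aut_component_def by (induction n) auto

lemma orbit_dist_component:
  assumes "\<sigma> \<in> S" "\<tau> \<in> S"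
  obtains d where "orbit_dist \<sigma> \<tau> = ereal d" "0 \<le> d"
proof -
  have "orbit_dist \<sigma> \<tau> < \<infinity>"
    using orbit_dist_le[OF component_Stab[OF assms(2)], of \<sigma>] stab_dist_finite_on_component[OF S assms]
    by (rule le_less_trans)
  then show thesis using that orbit_dist_nonneg[of \<sigma> \<tau>] by (cases "orbit_dist \<sigma> \<tau>") auto
qed

lemma orbit_dist_aut_act_funpow:
  assumes "\<sigma> \<in> S" "\<tau> \<in> S"
  shows "orbit_dist ((aut_act D \<nu> \<Lambda> F ^^ n) \<sigma>) ((aut_act D \<nu> \<Lambda> F ^^ n) \<tau>) \<le> orbit_dist \<sigma> \<tau>"
proof (induction n)
  case (Suc n)
  let ?\<sigma> = "(aut_act D \<nu> \<Lambda> F ^^ n) \<sigma>" and ?\<tau> = "(aut_act D \<nu> \<Lambda> F ^^ n) \<tau>"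
  have "orbit_dist (aut_act D \<nu> \<Lambda> F ?\<sigma>) (aut_act D \<nu> \<Lambda> F ?\<tau>) \<le> orbit_dist ?\<sigma> ?\<tau>"
    unfolding orbit_dist_def
  proof (rule INF_mono)
    fix a :: complex
    have "?\<sigma> \<in> Stab D \<nu> \<Lambda> N" "aut_act D \<nu> \<Lambda> F ?\<sigma> \<in> Stab D \<nu> \<Lambda> N"
      "?\<tau> \<in> Stab D \<nu> \<Lambda> N" "aut_act D \<nu> \<Lambda> F ?\<tau> \<in> Stab D \<nu> \<Lambda> N"
      using component_Stab aut_act_funpow_in[of _ n] aut_act_funpow_in[of _ "Suc n"] assms by auto
    then show "\<exists>b\<in>UNIV. stab_dist D \<nu> (aut_act D \<nu> \<Lambda> F ?\<sigma>) (c_act \<Lambda> (aut_act D \<nu> \<Lambda> F ?\<tau>) b)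
        \<le> stab_dist D \<nu> ?\<sigma> (c_act \<Lambda> ?\<tau> a)"
      using stab_dist_le_aut_act[OF F_Aut] by blast
  qed
  then show ?case using Suc by simp
qed simp

lemma quot_act_funpow:
  "(quot_act D \<nu> \<Lambda> F ^^ n) (c_orbit \<Lambda> \<sigma>) = c_orbit \<Lambda> ((aut_act D \<nu> \<Lambda> F ^^ n) \<sigma>)"
proof (induction n)
  case (Suc n)
  have "quot_act D \<nu> \<Lambda> F (c_orbit \<Lambda> \<tau>) = c_orbit \<Lambda> (aut_act D \<nu> \<Lambda> F \<tau>)" for \<tau>
    unfolding quot_act_def c_orbit_def by (simp add: image_image aut_act_c_act[OF F_Aut])
  then show ?case using Suc by simp
qed simp

lemma orbit_dist_iterate_limit:
  assumes \<sigma>: "\<sigma> \<in> S"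
  shows "\<exists>l. \<forall>\<tau> \<in> S. (\<lambda>n. orbit_dist \<tau> ((aut_act D \<nu> \<Lambda> F ^^ n) \<tau>) / ereal (real n)) \<longlonglongrightarrow> ereal l"
proof -
  let ?f = "aut_act D \<nu> \<Lambda> F"
  define u where "u \<tau> n = real_of_ereal (orbit_dist \<tau> ((?f ^^ n) \<tau>))" for \<tau> n
  have u: "orbit_dist \<tau> ((?f ^^ n) \<tau>) = ereal (u \<tau> n)" "0 \<le> u \<tau> n" if \<tau>: "\<tau> \<in> S" for \<tau> n
  proof -
    obtain d where "orbit_dist \<tau> ((?f ^^ n) \<tau>) = ereal d" "0 \<le> d"
      using orbit_dist_component[OF \<tau> aut_act_funpow_in[OF \<tau>, of n]] by blast
    then show "orbit_dist \<tau> ((?f ^^ n) \<tau>) = ereal (u \<tau> n)" "0 \<le> u \<tau> n"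
      unfolding u_def by simp_all
  qed
  note tri = orbit_dist_triangle[OF component_Stab component_Stab component_Stab]
  have "u \<sigma> (m + n) \<le> u \<sigma> m + u \<sigma> n" for m n
  proof -
    have "orbit_dist \<sigma> ((?f ^^ (m + n)) \<sigma>)
        \<le> orbit_dist \<sigma> ((?f ^^ m) \<sigma>) + orbit_dist ((?f ^^ m) \<sigma>) ((?f ^^ m) ((?f ^^ n) \<sigma>))"
      using tri[OF \<sigma> aut_act_funpow_in[OF \<sigma>, of m] aut_act_funpow_in[OF \<sigma>, of "m + n"]]
      by (simp add: funpow_add)
    also have "\<dots> \<le> orbit_dist \<sigma> ((?f ^^ m) \<sigma>) + orbit_dist \<sigma> ((?f ^^ n) \<sigma>)"
      using orbit_dist_aut_act_funpow[OF \<sigma> aut_act_funpow_in[OF \<sigma>]] by (rule add_left_mono)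
    finally show ?thesis by (simp add: u[OF \<sigma>])
  qed
  then obtain l where l: "(\<lambda>n. u \<sigma> n / real n) \<longlonglongrightarrow> l"
    using subadditive_convergent[of "u \<sigma>"] u(2)[OF \<sigma>] by blast
  have "(\<lambda>n. orbit_dist \<tau> ((?f ^^ n) \<tau>) / ereal (real n)) \<longlonglongrightarrow> ereal l" if \<tau>: "\<tau> \<in> S" for \<tau>
  proof -
    obtain c where c: "orbit_dist \<sigma> \<tau> = ereal c" using orbit_dist_component[OF \<sigma> \<tau>] by blast
    obtain d where d: "orbit_dist \<tau> \<sigma> = ereal d" using orbit_dist_component[OF \<tau> \<sigma>] by blast
    \<comment> \<open>Go from \<pi> to its iterate by way of \<rho> and the iterate of \<rho>.
      Taking both directions into the constant replaces symmetry of \<open>orbit_dist\<close>, and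
      \<open>cd\<close> holds for either assignment of \<sigma> and \<tau>.\<close>
    have le: "u \<pi> n \<le> u \<rho> n + (c + d)"
      if \<pi>: "\<pi> \<in> S" and \<rho>: "\<rho> \<in> S" and cd: "orbit_dist \<pi> \<rho> + orbit_dist \<rho> \<pi> = ereal (c + d)" for \<pi> \<rho> n
    proof -
      have "orbit_dist \<pi> ((?f ^^ n) \<pi>) \<le> orbit_dist \<pi> ((?f ^^ n) \<rho>) + orbit_dist ((?f ^^ n) \<rho>) ((?f ^^ n) \<pi>)"
        by (rule tri) (use \<pi> \<rho> aut_act_funpow_in in auto)
      also have "\<dots> \<le> orbit_dist \<pi> ((?f ^^ n) \<rho>) + orbit_dist \<rho> \<pi>"
        using orbit_dist_aut_act_funpow[OF \<rho> \<pi>] by (rule add_left_mono)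
      also have "\<dots> \<le> (orbit_dist \<pi> \<rho> + orbit_dist \<rho> ((?f ^^ n) \<rho>)) + orbit_dist \<rho> \<pi>"
        using tri[OF \<pi> \<rho> aut_act_funpow_in[OF \<rho>]] by (rule add_right_mono)
      also have "\<dots> = orbit_dist \<rho> ((?f ^^ n) \<rho>) + (orbit_dist \<pi> \<rho> + orbit_dist \<rho> \<pi>)"
        by (simp add: ac_simps)
      finally show ?thesis unfolding cd by (simp add: u[OF \<pi>] u[OF \<rho>])
    qed
    have "\<bar>u \<tau> n - u \<sigma> n\<bar> \<le> c + d" for n
      using le[OF \<sigma> \<tau>, of n] le[OF \<tau> \<sigma>, of n] c d by (simp add: add.commute abs_le_iff)
    then have "norm (u \<tau> n / real n - u \<sigma> n / real n) \<le> (c + d) / real n" for n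
      by (simp add: diff_divide_distrib[symmetric] divide_right_mono)
    then have "(\<lambda>n. u \<tau> n / real n - u \<sigma> n / real n) \<longlonglongrightarrow> 0"
      by (intro Lim_null_comparison[OF _ lim_const_over_n[of "c + d"]]) auto
    from tendsto_add[OF this l] have "(\<lambda>n. u \<tau> n / real n) \<longlonglongrightarrow> l" by simp
    then have "(\<lambda>n. ereal (u \<tau> n / real n)) \<longlonglongrightarrow> ereal l" by simp
    \<comment> \<open>Real and extended division are matched only at positive
      \<open>n\<close>.\<close>
    moreover have "\<forall>\<^sub>F n in sequentially. ereal (u \<tau> n / real n) = orbit_dist \<tau> ((?f ^^ n) \<tau>) / ereal (real n)"
      using eventually_gt_at_top[of 0] by eventually_elim (simp add: u[OF \<tau>])
    ultimately show ?thesis by (rule Lim_transform_eventually)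
  qed
  then show ?thesis by blast
qed

text \<open>The \<open>THE\<close> is met because the limit is common to all base points, and it is
  unique because the orbit of \<sigma> is one of them.\<close>

lemma eventual_displacement_limit:
  assumes \<sigma>: "\<sigma> \<in> S"
  shows "(\<lambda>n. orbit_dist \<sigma> ((aut_act D \<nu> \<Lambda> F ^^ n) \<sigma>) / ereal (real n)) \<longlonglongrightarrow>
    eventual_displacement (quot \<Lambda> S) (quot_dist D \<nu> \<Lambda>) (quot_act D \<nu> \<Lambda> F)"
proof -
  let ?f = "aut_act D \<nu> \<Lambda> F"
  have eq: "quot_dist D \<nu> \<Lambda> (c_orbit \<Lambda> \<tau>) ((quot_act D \<nu> \<Lambda> F ^^ n) (c_orbit \<Lambda> \<tau>)) = orbit_dist \<tau> ((?f ^^ n) \<tau>)"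
    if "\<tau> \<in> S" for \<tau> n
    using that by (simp add: quot_act_funpow quot_dist_orbits component_Stab aut_act_funpow_in)
  obtain l where l: "\<forall>\<tau> \<in> S. (\<lambda>n. orbit_dist \<tau> ((?f ^^ n) \<tau>) / ereal (real n)) \<longlonglongrightarrow> ereal l"
    using orbit_dist_iterate_limit[OF \<sigma>] by blast
  have "eventual_displacement (quot \<Lambda> S) (quot_dist D \<nu> \<Lambda>) (quot_act D \<nu> \<Lambda> F) = ereal l"
    unfolding eventual_displacement_def
  proof (rule the_equality)
    show "\<forall>x \<in> quot \<Lambda> S. (\<lambda>n. quot_dist D \<nu> \<Lambda> x ((quot_act D \<nu> \<Lambda> F ^^ n) x) / ereal (real n)) \<longlonglongrightarrow> ereal l"
      using l unfolding quot_def by (simp add: eq)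
    fix l' assume "\<forall>x \<in> quot \<Lambda> S. (\<lambda>n. quot_dist D \<nu> \<Lambda> x ((quot_act D \<nu> \<Lambda> F ^^ n) x) / ereal (real n)) \<longlonglongrightarrow> l'"
    then have "(\<lambda>n. orbit_dist \<sigma> ((?f ^^ n) \<sigma>) / ereal (real n)) \<longlonglongrightarrow> l'"
      using \<sigma> unfolding quot_def by (simp add: eq)
    then show "l' = ereal l" using l \<sigma> LIMSEQ_unique by blast
  qed
  then show ?thesis using l \<sigma> by simp
qed

section \<open>Mass growth against displacement\<close>

lemma mass_aut_act_funpow:
  assumes \<sigma>: "\<sigma> \<in> S" and E: "E \<in> nonzero_obs D"
  shows "(fob F ^^ n) E \<in> nonzero_obs D \<and> mass D \<nu> ((aut_act D \<nu> \<Lambda> F ^^ n) \<sigma>) ((fob F ^^ n) E) = mass D \<nu> \<sigma> E"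
proof (induction n)
  case (Suc n)
  have "(aut_act D \<nu> \<Lambda> F ^^ n) \<sigma> \<in> Stab D \<nu> \<Lambda> N" "aut_act D \<nu> \<Lambda> F ((aut_act D \<nu> \<Lambda> F ^^ n) \<sigma>) \<in> Stab D \<nu> \<Lambda> N"
    using component_Stab aut_act_funpow_in[OF \<sigma>, of n] aut_act_funpow_in[OF \<sigma>, of "Suc n"] by auto
  from aut_act_invariants(1,2)[OF F_Aut this, of "(fob F ^^ n) E"] Suc show ?case by simp
qed (use E in simp)

text \<open>Kept general in \<open>H\<close>, with conditions on objects only, so as to cover the
  auto-equivalence and its quasi-inverse alike.\<close>

lemma mass_growth_le:
  assumes \<sigma>: "\<sigma> \<in> S" and H: "\<And>E k. E \<in> Ob D \<Longrightarrow> (fob H ^^ k) E \<in> Ob D"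
      "\<And>E k. E \<in> Ob D \<Longrightarrow> zero_ob D ((fob H ^^ k) E) \<longleftrightarrow> zero_ob D E"
    and n: "0 < n"
    and step: "\<And>E k. E \<in> nonzero_obs D \<Longrightarrow>
      ln (mass D \<nu> \<sigma> ((fob H ^^ (k + n)) E)) \<le> ln (mass D \<nu> \<sigma> ((fob H ^^ k) E)) + c"
  shows "mass_growth D \<nu> \<sigma> 0 H \<le> ereal (c / real n)"
  unfolding mass_growth_def
proof (rule SUP_least)
  fix E assume E: "E \<in> Ob D"
  show "limsup (\<lambda>k. elog (mass D \<nu> \<sigma> ((fob H ^^ k) E)) / ereal (real k)) \<le> ereal (c / real n)"
  proof (cases "zero_ob D E")
    \<comment> \<open>A zero object stays zero, so every term with positive \<open>k\<close> is
      minus infinity.\<close>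
    case True
    have "\<forall>\<^sub>F k in sequentially. elog (mass D \<nu> \<sigma> ((fob H ^^ k) E)) / ereal (real k) \<le> ereal (c / real n)"
      using eventually_gt_at_top[of 0]
      by eventually_elim (simp add: mass_t_def H(2)[OF E] True elog_def)
    then show ?thesis by (rule Limsup_bounded)
  next
    case False
    then have E': "E \<in> nonzero_obs D" using E unfolding nonzero_obs_def by simp
    have "(fob H ^^ k) E \<in> nonzero_obs D" for k using H E False unfolding nonzero_obs_def by simp
    then have "mass D \<nu> \<sigma> ((fob H ^^ k) E) \<noteq> 0" for k using mass_pos[OF component_Stab[OF \<sigma>]] by (metis less_irrefl)
    then show ?thesis using limsup_le_of_step[of n "\<lambda>k. ln (mass D \<nu> \<sigma> ((fob H ^^ k) E))" c, OF n step[OF E']] by (simp add: elog_def)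
  qed
qed

lemma mass_growth_bounds:
  assumes \<sigma>: "\<sigma> \<in> S" and H: "quasi_inverse D F H" and n: "0 < n"
    and d: "stab_dist D \<nu> \<sigma> (c_act \<Lambda> ((aut_act D \<nu> \<Lambda> F ^^ n) \<sigma>) a) = ereal d"
  shows "mass_growth D \<nu> \<sigma> 0 F \<le> ereal ((d + pi * Im a) / real n)"
    and "mass_growth D \<nu> \<sigma> 0 H \<le> ereal ((d - pi * Im a) / real n)"
proof -
  let ?f = "aut_act D \<nu> \<Lambda> F"
  note St = component_Stab[OF \<sigma>] and Stn = component_Stab[OF aut_act_funpow_in[OF \<sigma>, of n]]
  \<comment> \<open>The translation by \<open>a\<close> contributes pi Im a to the logarithm of the
    mass. The two sides of this absolute value yield the two growth bounds, with opposite
    signs.\<close>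
  have key: "\<bar>ln (mass D \<nu> \<sigma> E) - ln (mass D \<nu> ((?f ^^ n) \<sigma>) E) - pi * Im a\<bar> \<le> d" if E: "E \<in> nonzero_obs D" for E
    using stab_dist_ge_ln_mass[OF E, of \<sigma> "c_act \<Lambda> ((?f ^^ n) \<sigma>) a"] mass_pos[OF St E] mass_pos[OF Stn E]
    unfolding d by (simp add: c_act_invariants[OF Stn E] ln_div ln_mult algebra_simps)
  have FOb: "(fob F ^^ k) E \<in> Ob D" if "E \<in> Ob D" for E k
    by (induction k) (use that functor_Ob[OF AutD(4)[OF F_Aut]] in auto)
  have Fz: "zero_ob D ((fob F ^^ k) E) \<longleftrightarrow> zero_ob D E" if "E \<in> Ob D" for E k
    by (induction k) (use FOb[OF that] autoequivalence_zero_ob_iff[OF AutD(3,2)[OF F_Aut]] in auto)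
  show "mass_growth D \<nu> \<sigma> 0 F \<le> ereal ((d + pi * Im a) / real n)"
  proof (rule mass_growth_le[OF \<sigma> FOb Fz n])
    fix E k assume E: "E \<in> nonzero_obs D"
    have Fk: "(fob F ^^ k) E \<in> nonzero_obs D" using mass_aut_act_funpow[OF \<sigma> E] by blast
    have "(fob F ^^ (k + n)) E = (fob F ^^ n) ((fob F ^^ k) E)"
      by (subst add.commute) (simp add: funpow_add)
    then show "ln (mass D \<nu> \<sigma> ((fob F ^^ (k + n)) E)) \<le> ln (mass D \<nu> \<sigma> ((fob F ^^ k) E)) + (d + pi * Im a)"
      using key[of "(fob F ^^ n) ((fob F ^^ k) E)"] mass_aut_act_funpow[OF \<sigma> Fk, of n] by auto
  qed
  have Hfun: "is_endofunctor D H" using H unfolding quasi_inverse_def by blast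
  have HOb: "(fob H ^^ k) E \<in> Ob D" if "E \<in> Ob D" for E k
    by (induction k) (use that functor_Ob[OF Hfun] in auto)
  have FH: "isomorphic D (fob F (fob H E)) E" if "E \<in> Ob D" for E
    using quasi_inverse_isomorphic(2)[OF H that] .
  have "zero_ob D (fob H E) \<longleftrightarrow> zero_ob D E" if E: "E \<in> Ob D" for E
    using autoequivalence_zero_ob_iff[OF AutD(3,2)[OF F_Aut] functor_Ob[OF Hfun E]]
      zero_ob_isomorphic[OF FH[OF E]] zero_ob_isomorphic[OF isomorphic_sym[OF FH[OF E]]] by blast
  then have Hz: "zero_ob D ((fob H ^^ k) E) \<longleftrightarrow> zero_ob D E" if "E \<in> Ob D" for E k
    by (induction k) (use HOb[OF that] in auto)
  have FnHn: "isomorphic D ((fob F ^^ m) ((fob H ^^ m) E)) E" if E: "E \<in> Ob D" for E m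
  proof (induction m)
    case (Suc m)
    have iter: "isomorphic D ((fob F ^^ m) A) ((fob F ^^ m) B)" if "isomorphic D A B" for A B
      by (induction m) (use that functor_isomorphic[OF AutD(4)[OF F_Aut]] in auto)
    \<comment> \<open>The pair in the middle, the last \<open>F\<close> next to the last
      \<open>H\<close>, cancels first; the remaining iterates of \<open>F\<close> transport that
      isomorphism.\<close>
    have "isomorphic D ((fob F ^^ m) (fob F (fob H ((fob H ^^ m) E)))) ((fob F ^^ m) ((fob H ^^ m) E))"
      by (intro iter FH HOb E)
    then show ?case using Suc isomorphic_trans by (simp add: funpow_swap1)
  qed (use E isomorphic_refl in simp)
  show "mass_growth D \<nu> \<sigma> 0 H \<le> ereal ((d - pi * Im a) / real n)"
  proof (rule mass_growth_le[OF \<sigma> HOb Hz n])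
    fix E k assume E: "E \<in> nonzero_obs D"
    have nz: "(fob H ^^ j) E \<in> nonzero_obs D" for j
      using HOb Hz nonzero_obsD[OF E] unfolding nonzero_obs_def by blast
    have eq: "(fob H ^^ (k + n)) E = (fob H ^^ n) ((fob H ^^ k) E)"
      by (subst add.commute) (simp add: funpow_add)
    have iso: "isomorphic D ((fob F ^^ n) ((fob H ^^ (k + n)) E)) ((fob H ^^ k) E)"
      unfolding eq by (rule FnHn[OF nonzero_obsD(1)[OF nz]])
    note m = mass_aut_act_funpow[OF \<sigma> nz, of n "k + n"]
    \<comment> \<open>Applying \<open>F\<close> n times to the (k+n)-th iterate gives back the k-th
      one, while the n-th image of \<sigma> measures the result as \<sigma> measured the
      original.\<close>
    have "mass D \<nu> ((?f ^^ n) \<sigma>) ((fob H ^^ k) E) = mass D \<nu> \<sigma> ((fob H ^^ (k + n)) E)"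
      using invariants_isomorphic(1)[OF Stn _ iso] m by simp
    then show "ln (mass D \<nu> \<sigma> ((fob H ^^ (k + n)) E)) \<le> ln (mass D \<nu> \<sigma> ((fob H ^^ k) E)) + (d - pi * Im a)"
      using key[OF nz, of k] by auto
  qed
qed

lemma mass_growth_le_orbit_dist:
  assumes \<sigma>: "\<sigma> \<in> S" and H: "quasi_inverse D F H" and n: "0 < n"
  shows "(mass_growth D \<nu> \<sigma> 0 F + mass_growth D \<nu> \<sigma> 0 H) / 2
    \<le> orbit_dist \<sigma> ((aut_act D \<nu> \<Lambda> F ^^ n) \<sigma>) / ereal (real n)" (is "?h / 2 \<le> _")
proof -
  \<comment> \<open>Multiplying by \<open>n\<close> postpones the division until the infimum over
    \<open>a\<close> has been taken. Only a finite \<open>?d\<close> has content: an infinite one is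
    trivial and a negative one impossible.\<close>
  have "ereal (real n) * (?h / 2) \<le> stab_dist D \<nu> \<sigma> (c_act \<Lambda> ((aut_act D \<nu> \<Lambda> F ^^ n) \<sigma>) a)" (is "_ \<le> ?d") for a
  proof (cases ?d)
    case (real d)
    have "?h \<le> ereal ((d + pi * Im a) / real n) + ereal ((d - pi * Im a) / real n)"
      using mass_growth_bounds[OF \<sigma> H n real] by (rule add_mono)
    also have "\<dots> = ereal (2 * d / real n)" by (simp add: add_divide_distrib[symmetric])
    finally have "?h / 2 \<le> ereal (2 * d / real n) / 2" by (intro ereal_divide_right_mono) auto
    then have "ereal (real n) * (?h / 2) \<le> ereal (real n) * (ereal (2 * d / real n) / 2)"
      by (rule ereal_mult_left_mono) simp
    also have "\<dots> = ereal d"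
    proof -
      have "ereal (2 * d / real n) / 2 = ereal (2 * d / real n / 2)" by (metis ereal_divide numeral_eq_ereal zero_neq_numeral)
      then show ?thesis using n by simp
    qed
    finally show ?thesis using real by simp
  qed (use stab_dist_nonneg[of \<sigma> "c_act \<Lambda> ((aut_act D \<nu> \<Lambda> F ^^ n) \<sigma>) a"] in auto)
  then have "ereal (real n) * (?h / 2) \<le> orbit_dist \<sigma> ((aut_act D \<nu> \<Lambda> F ^^ n) \<sigma>)"
    unfolding orbit_dist_def by (rule INF_greatest)
  then show ?thesis using n by (subst ereal_le_divide_pos) auto
qed

end

end

theorem lemma4p14:
  fixes D :: "('o, 'm) tri_cat"
    and \<nu> :: "('o \<Rightarrow>\<^sub>0 int) set \<Rightarrow> 'v::real_vector"
    and \<Lambda> :: "'v set"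
    and N :: "'v \<Rightarrow> real"
    and G :: 'o
    and S :: "('o, 'v) stab set"
    and \<sigma> :: "('o, 'v) stab"
    and \<alpha> \<alpha>_inv :: "('o, 'm) endofunctor"
  assumes "triangulated_category D"
    and "nonzero_obs D \<noteq> {}"
    and "finite_rank_lattice \<Lambda>"
    and "norm_on (span \<Lambda>) N"
    and "\<nu> \<in> epi (K0 D) (add_group \<Lambda>)"
    and "split_generator D G"
    and "S \<in> connected_components_of (stab_topology D \<nu> \<Lambda> N)"
    and "\<sigma> \<in> S"
    and "\<alpha> \<in> Aut_component D \<nu> \<Lambda> S"
    and "quasi_inverse D \<alpha> \<alpha>_inv"
  shows "eventual_displacement (quot \<Lambda> S) (quot_dist D \<nu> \<Lambda>) (quot_act D \<nu> \<Lambda> \<alpha>)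
    \<ge> (mass_growth D \<nu> \<sigma> 0 \<alpha> + mass_growth D \<nu> \<sigma> 0 \<alpha>_inv) / 2"
proof -
  interpret triangulated_category D by fact
  interpret stability_setting D \<nu> \<Lambda> N by unfold_locales fact+
  show ?thesis
    \<comment> \<open>The bound holds at every positive index; the witness 1 skips index 0.\<close>
    by (rule LIMSEQ_le_const[OF eventual_displacement_limit[OF assms(7,9,8)]])
      (use mass_growth_le_orbit_dist[OF assms(7,9,8,10)] in \<open>auto intro!: exI[of _ 1]\<close>)
qed

end
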